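(* Consider the bimodal piecewise affine system $$\dot x=\begin{cases}A_1x+b_1+Bu & \text{if } h^Tx>0\\ A_2x+b_2+Bu&\text{if } h^Tx<0\end{cases}$$ where $x,h\in\mathbb{R}^n$, $u\in\mathbb{R}^m$, and $A_i\in\mathbb{R}^{n\times n}$, $B\in\mathbb{R}^{n\times m}$, $b_i\in\mathbb{R}^n$, $i=1,2$, are constant. Let $\Delta A:=A_1-A_2$, $\Delta b:=b_1-b_2$, let $U\subseteq\mathbb{R}^n$ be the (open) state space, $\Sigma=\{x\in U:h^Tx=0\}$, and let $\mathcal{C}\subseteq U$ be a forward-invariant $K$-reachable set. Suppose there exist a norm, with associated matrix measure $\mu$, and positive constants $c_1,c_2$ such that for all $x\in\Sigma$ $$\mu(A_1)\le -c_1,\qquad \mu(A_2)\le -c_2,\qquad \mu(\Delta A\,x\,h^T)=0,\qquad \mu(\Delta b\,h^T)=0 .$$ Then the piecewise affine system is incrementally exponentially stable in $\mathcal{C}$ with convergence rate $c:=\min\{c_1,c_2\}$.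
   Context: The vector $h$ is nonzero. $u$ is an external input, the same for all solutions being compared. Standing assumption: solutions are understood in the sense of Filippov (on the part of $\Sigma$ where the two vector fields $f^+=A_1x+b_1+Bu$, $f^-=A_2x+b_2+Bu$ satisfy $h^Tf^+<0<h^Tf^-$, the motion follows the convex combination $f^s=(1-\lambda)f^++\lambda f^-$, $\lambda\in[0,1]$, with $h^Tf^s=0$), and right uniqueness of solutions holds in $U$. Matrix measure: for a norm $|\cdot|$ on $\mathbb{R}^n$ with induced matrix norm $\|\cdot\|$, $\mu(A)=\lim_{h\to0^+}\frac{\|I+hA\|-1}{h}$ (here $h$ is a scalar). $K$-reachable: $\mathcal{C}\subseteq\mathbb{R}^n$ is $K$-reachable ($K>0$) if for any $x_0,y_0\in\mathcal{C}$ there is a continuously differentiable curve $\gamma:[0,1]\to\mathcal{C}$ with $\gamma(0)=x_0$, $\gamma(1)=y_0$, $|\gamma'(r)|\le K|y_0-x_0|$ for all $r$. Forward invariant: solutions starting in $\mathcal{C}$ at time $t_0$ stay in $\mathcal{C}$ for all $t\ge t_0$. Incrementally exponentially stable in the forward-invariant set $\mathcal{C}$ with convergence rate $c>0$: there is a constant $K\ge1$ such that any two solutions $x(t),y(t)$ with $x(t_0)=x_0\in\mathcal{C}$, $y(t_0)=y_0\in\mathcal{C}$ satisfy $|x(t)-y(t)|\le K e^{-c(t-t_0)}|x_0-y_0|$ for all $t\ge t_0$, in the given norm. *)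

theory Defs
  imports "HOL-Analysis.Analysis"
begin

definition is_norm :: "(real^'n \<Rightarrow> real) \<Rightarrow> bool" where
  "is_norm N \<longleftrightarrow>
     (\<forall>x. N x = 0 \<longleftrightarrow> x = 0) \<and>
     (\<forall>a x. N (a *\<^sub>R x) = \<bar>a\<bar> * N x) \<and>
     (\<forall>x y. N (x + y) \<le> N x + N y)"

definition induced_matrix_norm :: "(real^'n \<Rightarrow> real) \<Rightarrow> real^'n^'n \<Rightarrow> real" where
  "induced_matrix_norm N A = (SUP x\<in>{x. N x = 1}. N (A *v x))"

(* The limit exists for every norm: the difference quotient is monotone in e and bounded below. *)
definition matrix_measure :: "(real^'n \<Rightarrow> real) \<Rightarrow> real^'n^'n \<Rightarrow> real" where
  "matrix_measure N A =
     Lim (at_right 0) (\<lambda>e. (induced_matrix_norm N (mat 1 + e *\<^sub>R A) - 1) / e)"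

definition outer_prod :: "real^'n \<Rightarrow> real^'n \<Rightarrow> real^'n^'n" where
  "outer_prod v w = (columnvector v :: real^1^'n) ** (rowvector w :: real^'n^1)"

definition affine_field ::
  "real^'n^'n \<Rightarrow> real^'n \<Rightarrow> real^'m^'n \<Rightarrow> (real \<Rightarrow> real^'m) \<Rightarrow> real \<Rightarrow> real^'n \<Rightarrow> real^'n" where
  "affine_field A b B u t x = A *v x + b + B *v u t"

(* Filippov's convexification of a bimodal system. On the switching hyperplane the segment is
   the set of all convex combinations (1 - l) fp + l fm. The sliding condition
   h \<bullet> x' = 0 is not imposed separately: an absolutely continuous x satisfies it at
   almost every time at which h \<bullet> x = 0. *)
definition filippov_map ::
  "real^'n \<Rightarrow> (real \<Rightarrow> real^'n \<Rightarrow> real^'n) \<Rightarrow> (real \<Rightarrow> real^'n \<Rightarrow> real^'n)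
     \<Rightarrow> real \<Rightarrow> real^'n \<Rightarrow> (real^'n) set" where
  "filippov_map h fp fm t x =
     (if h \<bullet> x > 0 then {fp t x}
      else if h \<bullet> x < 0 then {fm t x}
      else closed_segment (fp t x) (fm t x))"

definition pwa_filippov_map ::
  "real^'n \<Rightarrow> real^'n^'n \<Rightarrow> real^'n^'n \<Rightarrow> real^'n \<Rightarrow> real^'n \<Rightarrow> real^'m^'n \<Rightarrow> (real \<Rightarrow> real^'m)
     \<Rightarrow> real \<Rightarrow> real^'n \<Rightarrow> (real^'n) set" where
  "pwa_filippov_map h A1 A2 b1 b2 B u =
     filippov_map h (affine_field A1 b1 B u) (affine_field A2 b2 B u)"

definition absolutely_continuous_on :: "real set \<Rightarrow> (real \<Rightarrow> real^'n) \<Rightarrow> bool" where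
  "absolutely_continuous_on S f \<longleftrightarrow>
     (\<forall>\<epsilon>>0. \<exists>\<delta>>0. \<forall>(k::nat) (a::nat \<Rightarrow> real) (b::nat \<Rightarrow> real).
        (\<forall>i<k. a i \<le> b i \<and> {a i..b i} \<subseteq> S) \<and>
        (\<forall>i<k. \<forall>j<k. i \<noteq> j \<longrightarrow> {a i<..<b i} \<inter> {a j<..<b j} = {}) \<and>
        (\<Sum>i<k. b i - a i) < \<delta>
        \<longrightarrow> (\<Sum>i<k. norm (f (b i) - f (a i))) < \<epsilon>)"

(* Solution on the time interval J, inside the state space U, of the inclusion x' \<in> F t x. *)
definition inclusion_solution ::
  "(real \<Rightarrow> real^'n \<Rightarrow> (real^'n) set) \<Rightarrow> (real^'n) set \<Rightarrow> real set \<Rightarrow> (real \<Rightarrow> real^'n) \<Rightarrow> bool" where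
  "inclusion_solution F U J x \<longleftrightarrow>
     (\<forall>t\<in>J. x t \<in> U) \<and>
     (\<forall>a b. {a..b} \<subseteq> J \<longrightarrow> absolutely_continuous_on {a..b} x) \<and>
     (AE t in lebesgue. t \<in> J \<longrightarrow>
        (\<exists>v\<in>F t (x t). (x has_vector_derivative v) (at t within J)))"

(* T0 is the set of admissible initial times, for example UNIV or {0..}. *)
definition right_unique_solutions ::
  "(real \<Rightarrow> real^'n \<Rightarrow> (real^'n) set) \<Rightarrow> (real^'n) set \<Rightarrow> real set \<Rightarrow> bool" where
  "right_unique_solutions F U T0 \<longleftrightarrow>
     (\<forall>t0\<in>T0. \<forall>t1>t0. \<forall>x y.
        inclusion_solution F U {t0..<t1} x \<and> inclusion_solution F U {t0..<t1} y \<and> x t0 = y t0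
        \<longrightarrow> (\<forall>t\<in>{t0..<t1}. x t = y t))"

(* Staying in C for all t \<ge> t0 includes being defined for all t \<ge> t0, hence the
   existence clause; without it, a point whose solutions leave U in finite time would satisfy
   the invariance clause vacuously. *)
definition forward_invariant ::
  "(real \<Rightarrow> real^'n \<Rightarrow> (real^'n) set) \<Rightarrow> (real^'n) set \<Rightarrow> real set \<Rightarrow> (real^'n) set \<Rightarrow> bool" where
  "forward_invariant F U T0 C \<longleftrightarrow>
     (\<forall>t0\<in>T0. \<forall>x0\<in>C. \<exists>x. inclusion_solution F U {t0..} x \<and> x t0 = x0) \<and>
     (\<forall>t0\<in>T0. \<forall>x. inclusion_solution F U {t0..} x \<and> x t0 \<in> C \<longrightarrow> (\<forall>t\<ge>t0. x t \<in> C))"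

definition K_reachable :: "(real^'n \<Rightarrow> real) \<Rightarrow> real \<Rightarrow> (real^'n) set \<Rightarrow> bool" where
  "K_reachable N K C \<longleftrightarrow>
     K > 0 \<and>
     (\<forall>x0\<in>C. \<forall>y0\<in>C. \<exists>\<gamma> \<gamma>'.
        \<gamma> 0 = x0 \<and> \<gamma> 1 = y0 \<and>
        (\<forall>r\<in>{0..1}. \<gamma> r \<in> C) \<and>
        (\<forall>r\<in>{0..1}. (\<gamma> has_vector_derivative \<gamma>' r) (at r within {0..1})) \<and>
        continuous_on {0..1} \<gamma>' \<and>
        (\<forall>r\<in>{0..1}. N (\<gamma>' r) \<le> K * N (y0 - x0)))"

definition incrementally_exp_stable ::
  "(real^'n \<Rightarrow> real) \<Rightarrow> (real \<Rightarrow> real^'n \<Rightarrow> (real^'n) set) \<Rightarrow> (real^'n) set \<Rightarrow> real set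
     \<Rightarrow> (real^'n) set \<Rightarrow> real \<Rightarrow> bool" where
  "incrementally_exp_stable N F U T0 C c \<longleftrightarrow>
     c > 0 \<and>
     (\<exists>K\<ge>1. \<forall>t0\<in>T0. \<forall>x y.
        inclusion_solution F U {t0..} x \<and> inclusion_solution F U {t0..} y \<and>
        x t0 \<in> C \<and> y t0 \<in> C
        \<longrightarrow> (\<forall>t\<ge>t0. N (x t - y t) \<le> K * exp (- c * (t - t0)) * N (x t0 - y t0)))"

end

theory Submission
  imports Defs
begin

text \<open>
  Write \<open>g z = \<Delta>A z + \<Delta>b\<close> for the jump of the vector field at \<open>z \<in> \<Sigma>\<close>. If two solutions \<open>x\<close>, \<open>y\<close>
  are so close that the segment between them stays in \<open>U\<close>, and they are on different sides of \<open>\<Sigma>\<close>, then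
  the segment meets \<open>\<Sigma>\<close> at some \<open>z\<close>, and the difference of the velocities is a convex combination of
  \<open>A1 d\<close> and \<open>A2 d\<close>, where \<open>d = x - y\<close>, plus a nonnegative multiple of \<open>(h \<bullet> d) g z\<close>, which does not
  increase the norm. If both solutions slide, a vanishing measure of \<open>g h\<^sup>T\<close> makes the projection
  onto the hyperplane along \<open>g\<close> nonexpansive, and the difference of the sliding velocities is that
  projection of a convex combination of \<open>A1 d\<close> and \<open>A2 d\<close>. So nearby solutions contract at rate
  \<open>c\<close>. Distant ones are compared by subdividing the curve that joins their initial points:
  as \<open>U\<close> is open, every solution has a tube inside \<open>U\<close> over a compact time interval, and the
  contraction keeps neighbouring solutions in that tube, so the map from the curve parameter to the
  state at a fixed time is locally, hence globally, Lipschitz.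
\<close>

text \<open>The right derivative of the convex function \<open>N\<close> at \<open>d\<close> in
  direction \<open>e\<close> is at most \<open>k\<close>. The slack \<eta> avoids computing that
  derivative. The bound \<open>k\<close> is absolute, so exponential rates appear as multiples of
  \<open>N d\<close>.\<close>

definition growth_le :: "(real^'n \<Rightarrow> real) \<Rightarrow> real^'n \<Rightarrow> real^'n \<Rightarrow> real \<Rightarrow> bool" where
  "growth_le N d e k \<longleftrightarrow>
     (\<forall>\<eta>>0. \<forall>\<^sub>F \<epsilon> in at_right 0. N (d + \<epsilon> *\<^sub>R e) \<le> N d + \<epsilon> * (k + \<eta>))"

lemma eventually_at_right_0_scale:
  fixes a :: real
  assumes "a > 0" "eventually P (at_right 0)"
  shows "\<forall>\<^sub>F \<epsilon> in at_right 0. P (a * \<epsilon>)"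
proof -
  have "((\<lambda>\<epsilon>. a * \<epsilon>) \<longlongrightarrow> a * 0) (at_right 0)"
    by (intro tendsto_intros)
  moreover have "\<forall>\<^sub>F \<epsilon> in at_right 0. a * \<epsilon> \<in> {0<..} \<and> a * \<epsilon> \<noteq> 0"
    using eventually_at_right_less[of "0::real"] by eventually_elim (use assms in simp)
  ultimately have "filterlim (\<lambda>\<epsilon>. a * \<epsilon>) (at_right 0) (at_right 0)"
    by (simp add: filterlim_at)
  with assms(2) show ?thesis
    by (auto simp: filterlim_iff)
qed

section \<open>Norms on a finite-dimensional space and their comparison with the Euclidean
  norm\<close>

locale vector_norm =
  fixes N :: "real^'n \<Rightarrow> real"
  assumes is_norm: "is_norm N"
begin

lemma N_eq_0_iff [simp]: "N x = 0 \<longleftrightarrow> x = 0"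
  and N_scaleR [simp]: "N (a *\<^sub>R x) = \<bar>a\<bar> * N x"
  and N_triangle: "N (x + y) \<le> N x + N y"
  using is_norm unfolding is_norm_def by blast+

lemma N_zero [simp]: "N 0 = 0"
  by simp

lemma N_minus [simp]: "N (- x) = N x"
  using N_scaleR[of "-1" x] by simp

lemma N_diff_commute: "N (x - y) = N (y - x)"
  using N_minus[of "x - y"] by simp

lemma N_nonneg [simp]: "0 \<le> N x"
  using N_triangle[of x "- x"] by simp

lemma N_triangle_ineq: "N (x - z) \<le> N (x - y) + N (y - z)"
  using N_triangle[of "x - y" "y - z"] by simp

lemma N_diff_bound: "\<bar>N x - N y\<bar> \<le> N (x - y)"
  using N_triangle[of "x - y" y] N_triangle[of "y - x" x] N_diff_commute[of x y] by simp

lemma N_sum: "finite A \<Longrightarrow> N (sum f A) \<le> (\<Sum>a\<in>A. N (f a))"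
  by (induction A rule: finite_induct) (auto intro: order_trans[OF N_triangle])

lemma N_le_norm:
  obtains M where "M > 0" "\<And>x. N x \<le> M * norm x"
proof
  define M where "M = 1 + (\<Sum>b\<in>Basis. N b)"
  show "M > 0"
    unfolding M_def by (intro add_pos_nonneg sum_nonneg) auto
  fix x
  have "N x = N (\<Sum>b\<in>Basis. (x \<bullet> b) *\<^sub>R b)"
    by (simp only: euclidean_representation)
  also have "\<dots> \<le> (\<Sum>b\<in>Basis. \<bar>x \<bullet> b\<bar> * N b)"
    using N_sum[of Basis "\<lambda>b. (x \<bullet> b) *\<^sub>R b"] by simp
  also have "\<dots> \<le> (\<Sum>b\<in>Basis. norm x * N b)"
    by (intro sum_mono mult_right_mono Basis_le_norm) auto
  also have "\<dots> \<le> M * norm x"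
    unfolding M_def by (simp add: sum_distrib_left algebra_simps)
  finally show "N x \<le> M * norm x" .
qed

lemma continuous_on_N: "continuous_on S N"
proof -
  obtain M where M: "M > 0" "\<And>x. N x \<le> M * norm x"
    by (rule N_le_norm) blast
  have "M-lipschitz_on S N"
  proof (rule lipschitz_onI)
    fix x y
    show "dist (N x) (N y) \<le> M * dist x y"
      using N_diff_bound[of x y] M(2)[of "x - y"] by (simp add: dist_norm)
  qed (use M in simp)
  then show ?thesis
    by (rule lipschitz_on_continuous_on)
qed

text \<open>The continuous function \<open>N\<close> attains a minimum on the compact Euclidean unit
  sphere. It is positive there, and homogeneity extends the bound to all vectors.\<close>

lemma norm_le_N:
  obtains m where "m > 0" "\<And>x. norm x \<le> m * N x"
proof -
  have "compact (sphere 0 1 :: (real^'n) set)"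
    by simp
  moreover have "sphere 0 1 \<noteq> ({} :: (real^'n) set)"
    by simp
  ultimately obtain z where z: "z \<in> sphere 0 1" "\<And>x. x \<in> sphere 0 1 \<Longrightarrow> N z \<le> N x"
    using continuous_attains_inf[OF _ _ continuous_on_N] by metis
  have "z \<noteq> 0" using z by auto
  then have pos: "N z > 0"
    using N_nonneg[of z] by (simp add: less_le)
  show thesis
  proof
    show "inverse (N z) > 0" using pos by simp
    fix x
    show "norm x \<le> inverse (N z) * N x"
    proof (cases "x = 0")
      case False
      then have "N z \<le> N ((1 / norm x) *\<^sub>R x)"
        by (intro z) simp
      also have "\<dots> = N x / norm x" by simp
      finally show ?thesis
        using pos False by (simp add: field_simps)
    qed simp
  qed
qed

subsection \<open>Matrix measures\<close>

text \<open>A supremum of reals is an upper bound only for a bounded set, so this fact makes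
  \<open>induced_matrix_norm\<close> a true operator norm.\<close>

lemma induced_bdd_above: "bdd_above ((\<lambda>x. N (A *v x)) ` {x. N x = 1})"
proof -
  obtain M where M: "M > 0" "\<And>x. N x \<le> M * norm x"
    by (rule N_le_norm) blast
  obtain m where m: "m > 0" "\<And>x. norm x \<le> m * N x"
    by (rule norm_le_N) blast
  obtain L where L: "\<And>x. norm (A *v x) \<le> norm x * L" "L > 0"
    using bounded_linear.pos_bounded[OF matrix_vector_mul_bounded_linear] by blast
  show ?thesis
  proof (rule bdd_aboveI2)
    fix x assume "x \<in> {x. N x = 1}"
    then have "norm x \<le> m" using m(2)[of x] by simp
    then have "norm (A *v x) \<le> m * L"
      using L by (meson order_trans mult_right_mono less_imp_le)
    then show "N (A *v x) \<le> M * (m * L)"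
      using M by (meson order_trans mult_left_mono less_imp_le)
  qed
qed

lemma unit_vector_exists: "{x. N x = 1} \<noteq> {}"
proof -
  obtain z :: "real^'n" where "z \<noteq> 0"
    using zero_neq_one by blast
  then have "N ((1 / N z) *\<^sub>R z) = 1" by (simp add: abs_of_nonneg)
  then show ?thesis by blast
qed

lemma N_mult_le_induced: "N (A *v x) \<le> induced_matrix_norm N A * N x"
proof (cases "x = 0")
  case False
  then have pos: "N x > 0" using N_nonneg[of x] by (simp add: less_le)
  define y where "y = (1 / N x) *\<^sub>R x"
  have "N y = 1" using pos False by (simp add: y_def)
  then have "N (A *v y) \<le> induced_matrix_norm N A"
    unfolding induced_matrix_norm_def by (intro cSUP_upper induced_bdd_above) auto
  moreover have "N (A *v y) = N (A *v x) / N x"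
    using N_nonneg[of x] by (simp add: y_def matrix_vector_mult_scaleR)
  ultimately show ?thesis using pos by (simp add: field_simps)
qed simp

lemma induced_le: "(\<And>x. N x = 1 \<Longrightarrow> N (A *v x) \<le> k) \<Longrightarrow> induced_matrix_norm N A \<le> k"
  unfolding induced_matrix_norm_def by (rule cSUP_least[OF unit_vector_exists]) auto

abbreviation "measure_quotient A e \<equiv> (induced_matrix_norm N (mat 1 + e *\<^sub>R A) - 1) / e"

lemma id_plus_mult:
  fixes A :: "real^'m^'m"
  shows "(mat 1 + e *\<^sub>R A) *v x = x + e *\<^sub>R (A *v x)"
  by (simp add: matrix_vector_mult_add_rdistrib flip: scaleR_matrix_vector_assoc)

text \<open>With \<open>r = e / e'\<close>, the matrix I + e A is the convex combination of I and I
  + e' A with weights 1 - r and r, and the operator norm is convex.\<close>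

lemma measure_quotient_mono:
  assumes "0 < e" "e \<le> e'"
  shows "measure_quotient A e \<le> measure_quotient A e'"
proof -
  let ?n = "induced_matrix_norm N (mat 1 + e' *\<^sub>R A)"
  define r where "r = e / e'"
  have r: "0 \<le> r" "r \<le> 1" "e = r * e'" using assms by (auto simp: r_def)
  have "induced_matrix_norm N (mat 1 + e *\<^sub>R A) \<le> (1 - r) + r * ?n"
  proof (rule induced_le)
    fix x assume x: "N x = 1"
    have "x + e *\<^sub>R (A *v x) = (1 - r) *\<^sub>R x + r *\<^sub>R (x + e' *\<^sub>R (A *v x))"
      by (simp add: r algebra_simps)
    then have "N (x + e *\<^sub>R (A *v x)) \<le> (1 - r) * N x + r * N (x + e' *\<^sub>R (A *v x))"
      using N_triangle[of "(1 - r) *\<^sub>R x" "r *\<^sub>R (x + e' *\<^sub>R (A *v x))"] r by simp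
    also have "\<dots> \<le> (1 - r) + r * ?n"
      using N_mult_le_induced[of "mat 1 + e' *\<^sub>R A" x] x r
      by (auto simp: id_plus_mult intro: mult_left_mono)
    finally show "N ((mat 1 + e *\<^sub>R A) *v x) \<le> (1 - r) + r * ?n"
      by (simp add: id_plus_mult)
  qed
  then have "induced_matrix_norm N (mat 1 + e *\<^sub>R A) - 1 \<le> r * (?n - 1)"
    by (simp add: algebra_simps)
  then show ?thesis using assms by (simp add: r_def field_simps)
qed

text \<open>At a unit vector x the triangle inequality gives 1 <= N(x + e A x) + e N(A x); both
  terms are bounded by operator norms.\<close>

lemma measure_quotient_ge:
  assumes "0 < e"
  shows "- induced_matrix_norm N A \<le> measure_quotient A e"
proof -
  obtain x where x: "N x = 1" using unit_vector_exists by blast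
  have "1 \<le> N (x + e *\<^sub>R (A *v x)) + e * N (A *v x)"
    using N_diff_bound[of x "x + e *\<^sub>R (A *v x)"] x assms by simp
  also have "\<dots> \<le> induced_matrix_norm N (mat 1 + e *\<^sub>R A) + e * induced_matrix_norm N A"
    using N_mult_le_induced[of "mat 1 + e *\<^sub>R A" x] N_mult_le_induced[of A x] x assms
    by (intro add_mono mult_left_mono) (auto simp: id_plus_mult)
  finally show ?thesis using assms by (simp add: field_simps)
qed

text \<open>A monotone quotient that is bounded below converges to its infimum from the right, so
  the \<open>Lim\<close> in \<open>matrix_measure\<close> denotes an actual limit.\<close>

lemma matrix_measure_tendsto: "(measure_quotient A \<longlongrightarrow> matrix_measure N A) (at_right 0)"
proof -
  define l where "l = Inf (measure_quotient A ` {0<..})"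
  have bdd: "bdd_below (measure_quotient A ` {0<..})"
    using measure_quotient_ge by (intro bdd_belowI2) auto
  have lim: "(measure_quotient A \<longlongrightarrow> l) (at_right 0)"
  proof (rule order_tendstoI)
    fix a assume "a < l"
    show "\<forall>\<^sub>F e in at_right 0. a < measure_quotient A e"
      using eventually_at_right_less[of "0::real"]
    proof eventually_elim
      case (elim e)
      then have "l \<le> measure_quotient A e"
        unfolding l_def by (intro cINF_lower bdd) auto
      with \<open>a < l\<close> show ?case by simp
    qed
  next
    fix a assume "l < a"
    then obtain e' where e': "e' > 0" "measure_quotient A e' < a"
      unfolding l_def using bdd by (subst (asm) cINF_less_iff) auto
    have "\<forall>\<^sub>F e in at_right 0. e \<in> {0<..<e'}"
      using e' by (intro eventually_at_right_real)
    then show "\<forall>\<^sub>F e in at_right 0. measure_quotient A e < a"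
    proof eventually_elim
      case (elim e)
      then show ?case using measure_quotient_mono[of e e' A] e' by simp
    qed
  qed
  then have "matrix_measure N A = l"
    unfolding matrix_measure_def by (intro tendsto_Lim) simp_all
  with lim show ?thesis by simp
qed

text \<open>Links the matrix measure to single vectors: N(d + e A d) is at most the operator norm of
  I + e A times N d, and that operator norm is at most 1 + e (k + \<eta>') for small e.\<close>

lemma growth_le_matrix_measure:
  assumes "matrix_measure N A \<le> k"
  shows "growth_le N d (A *v d) (k * N d)"
  unfolding growth_le_def
proof (intro allI impI)
  fix \<eta> :: real assume "\<eta> > 0"
  \<comment> \<open>Scaled so that \<eta>' times \<open>N d\<close> stays below \<eta>; the summand
    1 covers the case \<open>d = 0\<close>.\<close>
  define \<eta>' where "\<eta>' = \<eta> / (N d + 1)"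
  have Nd: "N d + 1 > 0" using N_nonneg[of d] by linarith
  have "\<eta>' > 0" unfolding \<eta>'_def using \<open>\<eta> > 0\<close> Nd by simp
  have small: "\<eta>' * N d \<le> \<eta>"
    unfolding \<eta>'_def using \<open>\<eta> > 0\<close> Nd by (simp add: field_simps)
  have "\<forall>\<^sub>F e in at_right 0. measure_quotient A e < k + \<eta>'"
    using \<open>\<eta>' > 0\<close> assms by (intro order_tendstoD(2)[OF matrix_measure_tendsto]) simp
  with eventually_at_right_less[of "0::real"]
  show "\<forall>\<^sub>F e in at_right 0. N (d + e *\<^sub>R (A *v d)) \<le> N d + e * (k * N d + \<eta>)"
  proof eventually_elim
    case (elim e)
    then have ind: "induced_matrix_norm N (mat 1 + e *\<^sub>R A) \<le> 1 + e * (k + \<eta>')"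
      by (simp add: field_simps)
    have "N (d + e *\<^sub>R (A *v d)) \<le> induced_matrix_norm N (mat 1 + e *\<^sub>R A) * N d"
      using N_mult_le_induced[of "mat 1 + e *\<^sub>R A" d] by (simp add: id_plus_mult)
    also have "\<dots> \<le> (1 + e * (k + \<eta>')) * N d"
      using ind by (intro mult_right_mono) auto
    also have "\<dots> = N d + e * (k * N d + \<eta>' * N d)"
      by (simp add: algebra_simps)
    also have "\<dots> \<le> N d + e * (k * N d + \<eta>)"
      using small elim by (intro add_left_mono mult_left_mono) auto
    finally show ?case .
  qed
qed

section \<open>Calculus of one-sided growth bounds\<close>

lemma growth_le_add:
  assumes "growth_le N d e1 k1" "growth_le N d e2 k2"
  shows "growth_le N d (e1 + e2) (k1 + k2)"
  unfolding growth_le_def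
proof (intro allI impI)
  fix \<eta> :: real assume "\<eta> > 0"
  then have "\<eta> / 2 > 0" by simp
  then have 1: "\<forall>\<^sub>F \<epsilon> in at_right 0. N (d + \<epsilon> *\<^sub>R e1) \<le> N d + \<epsilon> * (k1 + \<eta> / 2)"
    and 2: "\<forall>\<^sub>F \<epsilon> in at_right 0. N (d + \<epsilon> *\<^sub>R e2) \<le> N d + \<epsilon> * (k2 + \<eta> / 2)"
    using assms unfolding growth_le_def by blast+
  have pos2: "(2::real) > 0" by simp
  show "\<forall>\<^sub>F \<epsilon> in at_right 0. N (d + \<epsilon> *\<^sub>R (e1 + e2)) \<le> N d + \<epsilon> * (k1 + k2 + \<eta>)"
    using eventually_at_right_0_scale[OF pos2 1] eventually_at_right_0_scale[OF pos2 2]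
  proof eventually_elim
    case (elim \<epsilon>)
    \<comment> \<open>The combined step is the midpoint of two single steps of double length, which
      is why both bounds were rescaled by 2.\<close>
    have "d + \<epsilon> *\<^sub>R (e1 + e2)
        = (1/2) *\<^sub>R (d + (2 * \<epsilon>) *\<^sub>R e1) + (1/2) *\<^sub>R (d + (2 * \<epsilon>) *\<^sub>R e2)"
      by (simp add: algebra_simps flip: scaleR_add_left)
    then have "N (d + \<epsilon> *\<^sub>R (e1 + e2))
        \<le> 1/2 * N (d + (2 * \<epsilon>) *\<^sub>R e1) + 1/2 * N (d + (2 * \<epsilon>) *\<^sub>R e2)"
      using N_triangle[of "(1/2) *\<^sub>R (d + (2 * \<epsilon>) *\<^sub>R e1)" "(1/2) *\<^sub>R (d + (2 * \<epsilon>) *\<^sub>R e2)"]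
      by simp
    also have "\<dots> \<le> N d + \<epsilon> * (k1 + k2 + \<eta>)"
      using elim by (simp add: algebra_simps)
    finally show ?case .
  qed
qed

lemma growth_le_scaleR:
  assumes "growth_le N d e k" "a \<ge> 0"
  shows "growth_le N d (a *\<^sub>R e) (a * k)"
proof (cases "a = 0")
  case True
  then show ?thesis
    unfolding growth_le_def
    by (auto intro!: eventually_mono[OF eventually_at_right_less[of "0::real"]])
next
  case False
  with assms have a: "a > 0" by simp
  show ?thesis
    unfolding growth_le_def
  proof (intro allI impI)
    fix \<eta> :: real assume "\<eta> > 0"
    with a have "\<eta> / a > 0" by simp
    with assms(1) have "\<forall>\<^sub>F \<epsilon> in at_right 0. N (d + \<epsilon> *\<^sub>R e) \<le> N d + \<epsilon> * (k + \<eta> / a)"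
      unfolding growth_le_def by blast
    from eventually_at_right_0_scale[OF a this]
    show "\<forall>\<^sub>F \<epsilon> in at_right 0. N (d + \<epsilon> *\<^sub>R a *\<^sub>R e) \<le> N d + \<epsilon> * (a * k + \<eta>)"
    proof eventually_elim
      case (elim \<epsilon>)
      have "a * \<epsilon> * (k + \<eta> / a) = \<epsilon> * (a * k + \<eta>)"
        using a by (simp add: distrib_left)
      moreover have "(a * \<epsilon>) *\<^sub>R e = \<epsilon> *\<^sub>R a *\<^sub>R e"
        by (simp add: mult.commute)
      ultimately show ?case using elim by (simp only:)
    qed
  qed
qed

lemma growth_le_scaleR_both:
  assumes "growth_le N d e k" "a > 0"
  shows "growth_le N (a *\<^sub>R d) (a *\<^sub>R e) (a * k)"
  unfolding growth_le_def
proof (intro allI impI)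
  fix \<eta> :: real assume "\<eta> > 0"
  with assms have "\<eta> / a > 0" by simp
  with assms(1) have "\<forall>\<^sub>F \<epsilon> in at_right 0. N (d + \<epsilon> *\<^sub>R e) \<le> N d + \<epsilon> * (k + \<eta> / a)"
    unfolding growth_le_def by blast
  then show "\<forall>\<^sub>F \<epsilon> in at_right 0. N (a *\<^sub>R d + \<epsilon> *\<^sub>R a *\<^sub>R e) \<le> N (a *\<^sub>R d) + \<epsilon> * (a * k + \<eta>)"
  proof eventually_elim
    case (elim \<epsilon>)
    have "a *\<^sub>R d + \<epsilon> *\<^sub>R a *\<^sub>R e = a *\<^sub>R (d + \<epsilon> *\<^sub>R e)"
      by (simp add: algebra_simps)
    then have "N (a *\<^sub>R d + \<epsilon> *\<^sub>R a *\<^sub>R e) = a * N (d + \<epsilon> *\<^sub>R e)"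
      using assms(2) by simp
    also have "\<dots> \<le> a * (N d + \<epsilon> * (k + \<eta> / a))"
      using elim assms(2) by (intro mult_left_mono) auto
    also have "\<dots> = N (a *\<^sub>R d) + \<epsilon> * (a * k + \<eta>)"
      using assms(2) by (simp add: distrib_left)
    finally show ?case .
  qed
qed

text \<open>Along the ray through \<open>d\<close> the norm is linear as long as 1 + \<epsilon> a is
  positive, whatever the sign of \<open>a\<close>. With \<open>a = c\<close> this is the term
  produced by differentiating the weight exp(c t).\<close>

lemma growth_le_self: "growth_le N d (a *\<^sub>R d) (a * N d)"
  unfolding growth_le_def
proof (intro allI impI)
  fix \<eta> :: real assume "\<eta> > 0"
  have "((\<lambda>\<epsilon>. 1 + \<epsilon> * a) \<longlongrightarrow> 1 + 0 * a) (at_right 0)"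
    by (intro tendsto_intros)
  then have "\<forall>\<^sub>F \<epsilon> in at_right 0. 0 < 1 + \<epsilon> * a"
    by (rule order_tendstoD) simp
  with eventually_at_right_less[of "0::real"]
  show "\<forall>\<^sub>F \<epsilon> in at_right 0. N (d + \<epsilon> *\<^sub>R a *\<^sub>R d) \<le> N d + \<epsilon> * (a * N d + \<eta>)"
  proof eventually_elim
    case (elim \<epsilon>)
    have "d + \<epsilon> *\<^sub>R a *\<^sub>R d = (1 + \<epsilon> * a) *\<^sub>R d"
      by (simp add: algebra_simps)
    then have "N (d + \<epsilon> *\<^sub>R a *\<^sub>R d) = (1 + \<epsilon> * a) * N d"
      using elim by simp
    then show ?case using elim \<open>\<eta> > 0\<close> by (simp add: algebra_simps)
  qed
qed

lemma growth_le_minus: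
  "growth_le N d e k \<Longrightarrow> growth_le N (- d) (- e) k"
proof -
  have "- d + \<epsilon> *\<^sub>R (- e) = - (d + \<epsilon> *\<^sub>R e)" for \<epsilon>
    by simp
  then show "growth_le N d e k \<Longrightarrow> growth_le N (- d) (- e) k"
    unfolding growth_le_def by (simp only: N_minus)
qed

text \<open>Convexity: a nonpositive right derivative at \<open>d\<close> makes \<open>N\<close> monotone on the ray behind \<open>d\<close>.\<close>

lemma growth_le_0_backward:
  assumes "growth_le N d e 0" "\<tau> \<ge> 0"
  shows "N d \<le> N (d - \<tau> *\<^sub>R e)"
proof (rule field_le_epsilon)
  fix \<eta>' :: real assume "\<eta>' > 0"
  define \<eta> where "\<eta> = \<eta>' / (\<tau> + 1)"
  have "\<eta> > 0" "\<tau> * \<eta> \<le> \<eta>'" unfolding \<eta>_def using assms \<open>\<eta>' > 0\<close> by (auto simp: field_simps)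
  have "\<forall>\<^sub>F \<epsilon> in at_right 0. N (d + \<epsilon> *\<^sub>R e) \<le> N d + \<epsilon> * (0 + \<eta>)"
    using assms(1) \<open>\<eta> > 0\<close> unfolding growth_le_def by blast
  with eventually_at_right_less[of "0::real"]
  have "\<forall>\<^sub>F \<epsilon> in at_right 0. 0 < \<epsilon> \<and> N (d + \<epsilon> *\<^sub>R e) \<le> N d + \<epsilon> * \<eta>"
    by eventually_elim simp
  then obtain \<epsilon> :: real where \<epsilon>: "0 < \<epsilon>" "N (d + \<epsilon> *\<^sub>R e) \<le> N d + \<epsilon> * \<eta>"
    using eventually_happens'[OF trivial_limit_at_right_real] by blast
  \<comment> \<open>The point \<open>d\<close> lies between the backward and the forward point, with
    weights proportional to \<epsilon> and \<tau>; the common denominator is cleared.\<close>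
  have "(\<tau> + \<epsilon>) *\<^sub>R d = \<epsilon> *\<^sub>R (d - \<tau> *\<^sub>R e) + \<tau> *\<^sub>R (d + \<epsilon> *\<^sub>R e)"
    by (simp add: algebra_simps)
  then have "N ((\<tau> + \<epsilon>) *\<^sub>R d) \<le> N (\<epsilon> *\<^sub>R (d - \<tau> *\<^sub>R e)) + N (\<tau> *\<^sub>R (d + \<epsilon> *\<^sub>R e))"
    by (simp only: N_triangle)
  then have "(\<tau> + \<epsilon>) * N d \<le> \<epsilon> * N (d - \<tau> *\<^sub>R e) + \<tau> * N (d + \<epsilon> *\<^sub>R e)"
    using assms(2) \<epsilon> by simp
  also have "\<tau> * N (d + \<epsilon> *\<^sub>R e) \<le> \<tau> * (N d + \<epsilon> * \<eta>)"
    using \<epsilon> assms by (intro mult_left_mono) auto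
  finally have "\<epsilon> * N d \<le> \<epsilon> * (N (d - \<tau> *\<^sub>R e) + \<tau> * \<eta>)"
    by (simp add: algebra_simps)
  then have "N d \<le> N (d - \<tau> *\<^sub>R e) + \<tau> * \<eta>"
    using \<epsilon> by simp
  with \<open>\<tau> * \<eta> \<le> \<eta>'\<close> show "N d \<le> N (d - \<tau> *\<^sub>R e) + \<eta>'" by simp
qed

section \<open>Shears and projections along the jump direction\<close>

lemma shear_nonexpansive:
  assumes g: "\<And>d. growth_le N d ((h \<bullet> d) *\<^sub>R v) 0"
    and \<alpha>: "\<alpha> \<ge> 0" "1 + \<alpha> * (h \<bullet> v) > 0"
  shows "N (z + (\<alpha> * (h \<bullet> z)) *\<^sub>R v) \<le> N z"
proof -
  define d where "d = z + (\<alpha> * (h \<bullet> z)) *\<^sub>R v"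
  \<comment> \<open>The shear multiplies the component along \<open>h\<close> by 1 + \<alpha> (h .
    v) > 0. Hence z lies behind the image \<open>d\<close> on the ray in direction (h . d) v, at
    parameter \<tau>, where \<open>growth_le_0_backward\<close> applies.\<close>
  define \<tau> where "\<tau> = \<alpha> / (1 + \<alpha> * (h \<bullet> v))"
  have hd: "h \<bullet> d = (h \<bullet> z) * (1 + \<alpha> * (h \<bullet> v))"
    unfolding d_def by (simp add: algebra_simps)
  have "\<tau> * (h \<bullet> d) = \<alpha> * (h \<bullet> z)"
    unfolding hd \<tau>_def using \<alpha> by simp
  then have "d - \<tau> *\<^sub>R (h \<bullet> d) *\<^sub>R v = d - (\<alpha> * (h \<bullet> z)) *\<^sub>R v"
    by simp
  also have "\<dots> = z" by (simp add: d_def)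
  finally have "d - \<tau> *\<^sub>R (h \<bullet> d) *\<^sub>R v = z" .
  moreover have "N d \<le> N (d - \<tau> *\<^sub>R (h \<bullet> d) *\<^sub>R v)"
    using \<alpha> by (intro growth_le_0_backward g) (simp add: \<tau>_def)
  ultimately show ?thesis by (simp only: d_def)
qed

text \<open>If h . v were nonnegative, shears of every strength \<alpha> >= 0 would be nonexpansive,
  yet they move \<open>h\<close> arbitrarily far.\<close>

lemma shear_direction_neg:
  assumes g: "\<And>d. growth_le N d ((h \<bullet> d) *\<^sub>R v) 0" and "h \<noteq> 0" "v \<noteq> 0"
  shows "h \<bullet> v < 0"
proof (rule ccontr)
  assume "\<not> h \<bullet> v < 0"
  then have hv: "h \<bullet> v \<ge> 0" by simp
  have hh: "h \<bullet> h > 0" and Nv: "N v > 0"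
    using assms N_nonneg[of v] by (auto simp: less_le)
  \<comment> \<open>Gives a displacement of norm 2 N h + 1, whereas two vectors of norm at most N h
    differ by at most 2 N h.\<close>
  define \<alpha> where "\<alpha> = (2 * N h + 1) / ((h \<bullet> h) * N v)"
  have "\<alpha> \<ge> 0" unfolding \<alpha>_def using hh Nv by simp
  with hv have "N (h + (\<alpha> * (h \<bullet> h)) *\<^sub>R v) \<le> N h"
    by (intro shear_nonexpansive g) (auto intro: add_pos_nonneg)
  moreover have "N ((\<alpha> * (h \<bullet> h)) *\<^sub>R v) \<le> N (h + (\<alpha> * (h \<bullet> h)) *\<^sub>R v) + N h"
    using N_triangle[of "h + (\<alpha> * (h \<bullet> h)) *\<^sub>R v" "- h"] by simp
  moreover have "N ((\<alpha> * (h \<bullet> h)) *\<^sub>R v) = 2 * N h + 1"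
    using hh \<open>\<alpha> \<ge> 0\<close> assms(3) by (simp add: \<alpha>_def)
  ultimately show False by simp
qed

text \<open>The projection is the limiting shear with \<alpha> = -1 / (h . v), where the factor 1 +
  \<alpha> (h . v) degenerates to 0. Admissible shears of slightly smaller strength approximate
  it.\<close>

lemma projection_nonexpansive:
  assumes g: "\<And>d. growth_le N d ((h \<bullet> d) *\<^sub>R v) 0" and hv: "h \<bullet> v < 0"
  shows "N (z - ((h \<bullet> z) / (h \<bullet> v)) *\<^sub>R v) \<le> N z"
proof (rule field_le_epsilon)
  fix \<eta> :: real assume "\<eta> > 0"
  define a where "a = - 1 / (h \<bullet> v)"
  have a: "a > 0" using hv by (simp add: a_def field_simps)
  define c where "c = \<bar>h \<bullet> z\<bar> * N v + 1"
  have c: "c > 0" unfolding c_def by (intro add_nonneg_pos mult_nonneg_nonneg) auto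
  \<comment> \<open>The bound by \<open>a\<close> keeps the strength \<open>a - r\<close>
    nonnegative; the bound by \<eta> / c keeps the approximation error below \<eta>.\<close>
  define r where "r = min a (\<eta> / c)"
  have r: "0 < r" "r \<le> a" "r * c \<le> \<eta>"
    using a c \<open>\<eta> > 0\<close> by (auto simp: r_def min_def field_simps)
  define \<alpha> where "\<alpha> = a - r"
  have "1 + \<alpha> * (h \<bullet> v) = - r * (h \<bullet> v)"
    using hv by (simp add: \<alpha>_def a_def algebra_simps)
  then have "1 + \<alpha> * (h \<bullet> v) > 0"
    using hv r by (simp add: mult_pos_neg)
  then have 1: "N (z + (\<alpha> * (h \<bullet> z)) *\<^sub>R v) \<le> N z"
    using r by (intro shear_nonexpansive g) (auto simp: \<alpha>_def)
  have "z - ((h \<bullet> z) / (h \<bullet> v)) *\<^sub>R v = (z + (\<alpha> * (h \<bullet> z)) *\<^sub>R v) + (r * (h \<bullet> z)) *\<^sub>R v"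
    by (simp add: \<alpha>_def a_def algebra_simps)
  then have "N (z - ((h \<bullet> z) / (h \<bullet> v)) *\<^sub>R v)
      \<le> N (z + (\<alpha> * (h \<bullet> z)) *\<^sub>R v) + N ((r * (h \<bullet> z)) *\<^sub>R v)"
    using N_triangle by metis
  also have "N ((r * (h \<bullet> z)) *\<^sub>R v) = r * (\<bar>h \<bullet> z\<bar> * N v)"
    using r by (simp add: abs_mult)
  also have "r * (\<bar>h \<bullet> z\<bar> * N v) \<le> r * c"
    using r by (intro mult_left_mono) (auto simp: c_def)
  finally show "N (z - ((h \<bullet> z) / (h \<bullet> v)) *\<^sub>R v) \<le> N z + \<eta>"
    using 1 r by linarith
qed

end

section \<open>Growth bounds for differences of Filippov velocities\<close>

lemma outer_prod_mult: "outer_prod v w *v x = (w \<bullet> x) *\<^sub>R v"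
  by (simp add: outer_prod_def vec_eq_iff matrix_vector_mult_def matrix_matrix_mult_def
      columnvector_def rowvector_def inner_vec_def sum_distrib_left mult_ac)

text \<open>Treats both modes and sliding by one formula: the second field plus a multiple
  \<open>l\<close> of the jump. In a difference of two velocities the input and \<open>b2\<close>
  then cancel.\<close>

lemma pwa_filippov_mapE:
  assumes "v \<in> pwa_filippov_map h A1 A2 b1 b2 B u t x"
  obtains l where "0 \<le> l" "l \<le> 1" "h \<bullet> x > 0 \<Longrightarrow> l = 1" "h \<bullet> x < 0 \<Longrightarrow> l = 0"
    "v = A2 *v x + b2 + B *v u t + l *\<^sub>R ((A1 - A2) *v x + (b1 - b2))"
proof -
  consider "h \<bullet> x > 0" | "h \<bullet> x < 0" | "h \<bullet> x = 0" by linarith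
  then show thesis
  proof cases
    case 1
    then show thesis
      using assms that[of 1]
      by (simp add: pwa_filippov_map_def filippov_map_def affine_field_def algebra_simps)
  next
    case 2
    then show thesis
      using assms that[of 0]
      by (simp add: pwa_filippov_map_def filippov_map_def affine_field_def)
  next
    case 3
    then have "v \<in> closed_segment (affine_field A1 b1 B u t x) (affine_field A2 b2 B u t x)"
      using assms by (simp add: pwa_filippov_map_def filippov_map_def)
    then obtain r where r: "0 \<le> r" "r \<le> 1"
      "v = (1 - r) *\<^sub>R affine_field A1 b1 B u t x + r *\<^sub>R affine_field A2 b2 B u t x"
      by (auto simp: closed_segment_def)
    show thesis
      \<comment> \<open>The segment parameter weights its second endpoint, the mode-2 field, so the
        weight of mode 1 is the complement.\<close>
      by (rule that[of "1 - r"]) (use r 3 in \<open>auto simp: affine_field_def algebra_simps\<close>)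
  qed
qed

context vector_norm
begin

lemma growth_le_convex_combination:
  assumes "growth_le N d e1 k" "growth_le N d e2 k" "0 \<le> s" "s \<le> 1"
  shows "growth_le N d (s *\<^sub>R e1 + (1 - s) *\<^sub>R e2) k"
proof -
  have "growth_le N d (s *\<^sub>R e1 + (1 - s) *\<^sub>R e2) (s * k + (1 - s) * k)"
    using assms by (intro growth_le_add growth_le_scaleR) auto
  then show ?thesis by (simp add: algebra_simps)
qed

text \<open>In the sliding mode both velocities are tangent to the switching hyperplane, so their
  difference equals the projection along \<open>g\<close> of a convex combination of the two linear parts, and
  that projection does not increase the norm.\<close>

lemma growth_le_sliding:
  assumes g: "\<And>d. growth_le N d ((h \<bullet> d) *\<^sub>R g) 0" and "h \<noteq> 0"
    and a: "growth_le N d a k"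
    and tangent: "h \<bullet> d = 0" "h \<bullet> (a + r *\<^sub>R g) = 0"
  shows "growth_le N d (a + r *\<^sub>R g) k"
proof (cases "g = 0")
  case False
  then have neg: "h \<bullet> g < 0"
    using g \<open>h \<noteq> 0\<close> by (rule shear_direction_neg[rotated 2])
  have le: "N (d + \<epsilon> *\<^sub>R (a + r *\<^sub>R g)) \<le> N (d + \<epsilon> *\<^sub>R a)" for \<epsilon>
  proof -
    \<comment> \<open>By tangency, projecting \<open>d + \<epsilon> *\<^sub>R a\<close> along
      \<open>g\<close> adds exactly \<epsilon> r g, so the perturbed point with the jump is the
      projection of the one without it.\<close>
    have "h \<bullet> (d + \<epsilon> *\<^sub>R a) = - \<epsilon> * r * (h \<bullet> g)"
    proof -
      have "h \<bullet> a = - r * (h \<bullet> g)"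
        using tangent(2) by (simp add: inner_add_right)
      with tangent(1) show ?thesis by (simp add: inner_add_right)
    qed
    then have "(h \<bullet> (d + \<epsilon> *\<^sub>R a)) / (h \<bullet> g) = - \<epsilon> * r"
      using neg by simp
    then have "d + \<epsilon> *\<^sub>R (a + r *\<^sub>R g)
        = d + \<epsilon> *\<^sub>R a - ((h \<bullet> (d + \<epsilon> *\<^sub>R a)) / (h \<bullet> g)) *\<^sub>R g"
      by (simp add: algebra_simps)
    then show ?thesis
      using projection_nonexpansive[OF g neg, of "d + \<epsilon> *\<^sub>R a"] by (simp only:)
  qed
  show ?thesis
    unfolding growth_le_def
  proof (intro allI impI)
    fix \<eta> :: real assume "\<eta> > 0"
    with a have "\<forall>\<^sub>F \<epsilon> in at_right 0. N (d + \<epsilon> *\<^sub>R a) \<le> N d + \<epsilon> * (k + \<eta>)"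
      by (simp add: growth_le_def)
    then show "\<forall>\<^sub>F \<epsilon> in at_right 0. N (d + \<epsilon> *\<^sub>R (a + r *\<^sub>R g)) \<le> N d + \<epsilon> * (k + \<eta>)"
      by eventually_elim (use le order_trans in blast)
  qed
qed (use a in simp)

text \<open>The strict order of the heights fixes the sign: the jump contributes a nonnegative
  multiple of g at a point of the hyperplane, while h . d > 0, so \<open>jump\<close> absorbs
  it.\<close>

lemma growth_le_crossing:
  assumes A1: "\<And>d. growth_le N d (A1 *v d) (- c * N d)"
    and A2: "\<And>d. growth_le N d (A2 *v d) (- c * N d)"
    and jump: "\<And>z d. z \<in> U \<Longrightarrow> h \<bullet> z = 0 \<Longrightarrow>
      growth_le N d ((h \<bullet> d) *\<^sub>R ((A1 - A2) *v z + (b1 - b2))) 0"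
    and seg: "closed_segment x y \<subseteq> U"
    and v: "v \<in> pwa_filippov_map h A1 A2 b1 b2 B u t x"
    and w: "w \<in> pwa_filippov_map h A1 A2 b1 b2 B u t y"
    and gt: "h \<bullet> x > h \<bullet> y"
  shows "growth_le N (x - y) (v - w) (- c * N (x - y))"
proof -
  define d where "d = x - y"
  define g where "g z = (A1 - A2) *v z + (b1 - b2)" for z
  have g_diff: "g p = g q + (A1 - A2) *v (p - q)" for p q
    by (simp add: g_def algebra_simps)
  obtain l1 where l1: "0 \<le> l1" "l1 \<le> 1" "h \<bullet> x > 0 \<Longrightarrow> l1 = 1" "h \<bullet> x < 0 \<Longrightarrow> l1 = 0"
    and v': "v = A2 *v x + b2 + B *v u t + l1 *\<^sub>R g x"
    using v unfolding g_def by (rule pwa_filippov_mapE) blast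
  obtain l2 where l2: "0 \<le> l2" "l2 \<le> 1" "h \<bullet> y > 0 \<Longrightarrow> l2 = 1" "h \<bullet> y < 0 \<Longrightarrow> l2 = 0"
    and w': "w = A2 *v y + b2 + B *v u t + l2 *\<^sub>R g y"
    using w unfolding g_def by (rule pwa_filippov_mapE) blast
  have vw: "v - w = A2 *v d + l1 *\<^sub>R g x - l2 *\<^sub>R g y"
    by (simp add: v' w' d_def algebra_simps)
  \<comment> \<open>The point \<open>z\<close> must lie on the hyperplane only if the jump actually
    occurs; for two points strictly on one side \<beta> is 0 and \<open>z\<close> is
    arbitrary.\<close>
  obtain s \<beta> z where s: "0 \<le> s" "s \<le> 1" and \<beta>: "0 \<le> \<beta>"
    and z: "\<beta> \<noteq> 0 \<Longrightarrow> z \<in> closed_segment x y \<and> h \<bullet> z = 0"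
    and eq: "v - w = s *\<^sub>R (A1 *v d) + (1 - s) *\<^sub>R (A2 *v d) + \<beta> *\<^sub>R g z"
  proof -
    consider "h \<bullet> y \<ge> 0" | "h \<bullet> x \<le> 0" | "h \<bullet> x > 0" "h \<bullet> y < 0" by linarith
    then show thesis
    proof cases
      case 1
      with gt l1 have "l1 = 1" by simp
      then have eq: "v - w = A1 *v d + (1 - l2) *\<^sub>R g y"
        unfolding vw g_diff[of x y] d_def by (simp add: algebra_simps)
      have z: "h \<bullet> y = 0" if "1 - l2 \<noteq> 0"
        using l2(3) 1 that by linarith
      show thesis
        by (rule that[of 1 "1 - l2" y]) (use l2(2) z in \<open>simp_all add: eq\<close>)
    next
      case 2
      with gt l2 have "l2 = 0" by simp
      then have eq: "v - w = A2 *v d + l1 *\<^sub>R g x"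
        unfolding vw by simp
      have z: "h \<bullet> x = 0" if "l1 \<noteq> 0"
        using l1(4) 2 that by linarith
      show thesis
        by (rule that[of 0 l1 x]) (use l1(1) z in \<open>simp_all add: eq\<close>)
    next
      case 3
      \<comment> \<open>Parameter at which the segment from x to y meets the hyperplane. The change
        of the affine map g between z and x becomes the weight \<open>r\<close> of A1 against A2,
        which leaves one full jump at z.\<close>
      define r where "r = h \<bullet> x / (h \<bullet> x - h \<bullet> y)"
      define z where "z = (1 - r) *\<^sub>R x + r *\<^sub>R y"
      have r: "0 \<le> r" "r \<le> 1" using 3 by (auto simp: r_def field_simps)
      have "h \<bullet> z = h \<bullet> x - r * (h \<bullet> x - h \<bullet> y)"
        by (simp add: z_def algebra_simps)
      then have "h \<bullet> z = 0"
        using 3 by (simp add: r_def)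
      moreover have "z \<in> closed_segment x y"
        using r by (auto simp: z_def closed_segment_def)
      moreover have "x - z = r *\<^sub>R d"
        by (simp add: z_def d_def algebra_simps)
      then have gx: "g x = g z + r *\<^sub>R (A1 *v d - A2 *v d)"
        using g_diff[of x z]
        by (simp add: matrix_vector_mult_scaleR matrix_vector_mult_diff_rdistrib)
      have "l1 = 1" "l2 = 0" using l1 l2 3 by auto
      then have "v - w = r *\<^sub>R (A1 *v d) + (1 - r) *\<^sub>R (A2 *v d) + 1 *\<^sub>R g z"
        unfolding vw gx by (simp add: algebra_simps)
      ultimately show thesis
        using r by (intro that[of r 1 z]) simp_all
    qed
  qed
  have hd: "h \<bullet> d > 0" using gt by (simp add: d_def inner_diff_right)
  have "growth_le N d (\<beta> *\<^sub>R g z) 0"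
  proof (cases "\<beta> = 0")
    case True
    then show ?thesis using growth_le_self[of d 0] by simp
  next
    case False
    then have "growth_le N d ((h \<bullet> d) *\<^sub>R g z) 0"
      using z seg unfolding g_def by (intro jump) auto
    \<comment> \<open>Dividing by h . d > 0 turns the bound for (h . d) g into one for \<beta>
      g.\<close>
    from growth_le_scaleR[OF this, of "\<beta> / (h \<bullet> d)"] show ?thesis
      using \<beta> hd by simp
  qed
  from growth_le_add[OF growth_le_convex_combination[OF A1 A2 s, of d] this]
  have "growth_le N d (v - w) (- c * N d)"
    unfolding eq by simp
  then show ?thesis by (simp add: d_def)
qed

text \<open>Unequal heights reduce to the crossing case, up to exchanging x and y. At equal heights
  off the hyperplane both points use the same mode; on it, the tangency premise
  \<open>sliding\<close> allows the projection argument.\<close>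

lemma growth_le_pwa:
  assumes A1: "\<And>d. growth_le N d (A1 *v d) (- c * N d)"
    and A2: "\<And>d. growth_le N d (A2 *v d) (- c * N d)"
    and jump: "\<And>z d. z \<in> U \<Longrightarrow> h \<bullet> z = 0 \<Longrightarrow>
      growth_le N d ((h \<bullet> d) *\<^sub>R ((A1 - A2) *v z + (b1 - b2))) 0"
    and "h \<noteq> 0"
    and seg: "closed_segment x y \<subseteq> U"
    and v: "v \<in> pwa_filippov_map h A1 A2 b1 b2 B u t x"
    and w: "w \<in> pwa_filippov_map h A1 A2 b1 b2 B u t y"
    and sliding: "h \<bullet> x = 0 \<Longrightarrow> h \<bullet> y = 0 \<Longrightarrow> h \<bullet> (v - w) = 0"
  shows "growth_le N (x - y) (v - w) (- c * N (x - y))"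
proof -
  consider "h \<bullet> x > h \<bullet> y" | "h \<bullet> y > h \<bullet> x" | "h \<bullet> x = h \<bullet> y" by linarith
  then show ?thesis
  proof cases
    case 1
    show ?thesis
      by (rule growth_le_crossing[OF A1 A2 jump seg v w 1])
  next
    case 2
    have "growth_le N (y - x) (w - v) (- c * N (y - x))"
      using seg by (intro growth_le_crossing[OF A1 A2 jump _ w v 2])
        (simp_all add: closed_segment_commute)
    from growth_le_minus[OF this] show ?thesis
      using N_diff_commute[of x y] by simp
  next
    case 3
    define d where "d = x - y"
    define g where "g z = (A1 - A2) *v z + (b1 - b2)" for z
    obtain l1 where l1: "0 \<le> l1" "l1 \<le> 1" "h \<bullet> x > 0 \<Longrightarrow> l1 = 1" "h \<bullet> x < 0 \<Longrightarrow> l1 = 0"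
      and v': "v = A2 *v x + b2 + B *v u t + l1 *\<^sub>R g x"
      using v unfolding g_def by (rule pwa_filippov_mapE) blast
    obtain l2 where l2: "0 \<le> l2" "l2 \<le> 1" "h \<bullet> y > 0 \<Longrightarrow> l2 = 1" "h \<bullet> y < 0 \<Longrightarrow> l2 = 0"
      and w': "w = A2 *v y + b2 + B *v u t + l2 *\<^sub>R g y"
      using w unfolding g_def by (rule pwa_filippov_mapE) blast
    define a where "a = l1 *\<^sub>R (A1 *v d) + (1 - l1) *\<^sub>R (A2 *v d)"
    have a: "growth_le N d a (- c * N d)"
      unfolding a_def by (rule growth_le_convex_combination[OF A1 A2 l1(1,2)])
    have vw: "v - w = a + (l1 - l2) *\<^sub>R g y"
      by (simp add: v' w' d_def a_def g_def algebra_simps)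
    have "growth_le N d (v - w) (- c * N d)"
    proof (cases "h \<bullet> y = 0")
      case True
      have "h \<bullet> d = 0" using 3 by (simp add: d_def inner_diff_right)
      moreover have "h \<bullet> (a + (l1 - l2) *\<^sub>R g y) = 0"
        using sliding 3 True vw by simp
      moreover have "growth_le N d' ((h \<bullet> d') *\<^sub>R g y) 0" for d'
        using True seg unfolding g_def by (intro jump) auto
      ultimately show ?thesis
        unfolding vw using \<open>h \<noteq> 0\<close> a by (intro growth_le_sliding) auto
    next
      case False
      then have "l1 = l2" using 3 l1 l2 by (cases "h \<bullet> y > 0") auto
      then show ?thesis using a vw by simp
    qed
    then show ?thesis by (simp add: d_def)
  qed
qed

end

section \<open>Isolated points and derivatives at accumulation points\<close>

lemma countable_isolated_points:
  fixes Z :: "real set"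
  shows "countable {t \<in> Z. \<not> t islimpt Z}"
proof -
  \<comment> \<open>An isolated point is the only point of \<open>Z\<close> in some interval with
    rational endpoints, and each such interval accounts for at most one point.\<close>
  have "{t \<in> Z. \<not> t islimpt Z} \<subseteq> (\<Union>p\<in>\<rat>. \<Union>q\<in>\<rat>. {t. Z \<inter> {p<..<q} = {t}})"
  proof
    fix t assume "t \<in> {t \<in> Z. \<not> t islimpt Z}"
    then obtain e where t: "t \<in> Z" and e: "e > 0" "\<And>s. s \<in> Z \<Longrightarrow> dist s t < e \<Longrightarrow> s = t"
      by (auto simp: islimpt_approachable)
    obtain p where p: "p \<in> \<rat>" "t - e < p" "p < t"
      using Rats_dense_in_real[of "t - e" t] e by auto
    obtain q where q: "q \<in> \<rat>" "t < q" "q < t + e"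
      using Rats_dense_in_real[of t "t + e"] e by auto
    have unique: "s = t" if "s \<in> Z" "p < s" "s < q" for s
      using that p q by (intro e(2)) (simp_all add: dist_real_def abs_less_iff)
    have "Z \<inter> {p<..<q} = {t}"
    proof (intro equalityI subsetI)
      fix s assume "s \<in> Z \<inter> {p<..<q}"
      then have "s = t" by (intro unique) simp_all
      then show "s \<in> {t}" by simp
    qed (use t p q in simp)
    then show "t \<in> (\<Union>p\<in>\<rat>. \<Union>q\<in>\<rat>. {t. Z \<inter> {p<..<q} = {t}})"
      by (intro UN_I[OF p(1)] UN_I[OF q(1)]) simp
  qed
  moreover have "countable {t. Z \<inter> {p<..<q} = {t}}" for p q
  proof (rule countable_subset)
    show "{t. Z \<inter> {p<..<q} = {t}} \<subseteq> {THE t. Z \<inter> {p<..<q} = {t}}"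
    proof
      fix t assume "t \<in> {t. Z \<inter> {p<..<q} = {t}}"
      then have "(THE t. Z \<inter> {p<..<q} = {t}) = t" by simp
      then show "t \<in> {THE t. Z \<inter> {p<..<q} = {t}}" by simp
    qed
  qed simp
  then have "countable (\<Union>p\<in>\<rat>. \<Union>q\<in>\<rat>. {t. Z \<inter> {p<..<q} = {t}})"
    by (intro countable_UN countable_rat)
  ultimately show ?thesis by (rule countable_subset)
qed

text \<open>Difference quotients taken along \<open>Z\<close> are all 0, and limits within
  \<open>Z\<close> are unique at an accumulation point.\<close>

lemma vanishing_derivative_at_limit_point:
  fixes f :: "real \<Rightarrow> real"
  assumes "(f has_real_derivative D) (at t)" "\<And>s. s \<in> Z \<Longrightarrow> f s = 0" "t \<in> Z" "t islimpt Z"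
  shows "D = 0"
proof -
  have "(f has_real_derivative D) (at t within Z)"
    using assms(1) by (rule has_field_derivative_at_within)
  then have lim: "((\<lambda>s. (f s - f t) / (s - t)) \<longlongrightarrow> D) (at t within Z)"
    by (simp add: has_field_derivative_iff)
  have "((\<lambda>s. (f s - f t) / (s - t)) \<longlongrightarrow> 0) (at t within Z)"
    by (rule tendsto_eventually) (use assms in \<open>auto simp: eventually_at_filter\<close>)
  with lim show "D = 0"
    by (intro tendsto_unique[of "at t within Z"]) (auto simp: trivial_limit_within assms)
qed

subsection \<open>Absolute continuity\<close>

text \<open>Separates the condition on interval families from
  \<open>absolutely_continuous_on\<close>, so that families can be concatenated.\<close>

definition nonoverlapping_intervals ::
  "real set \<Rightarrow> nat \<Rightarrow> (nat \<Rightarrow> real) \<Rightarrow> (nat \<Rightarrow> real) \<Rightarrow> bool" where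
  "nonoverlapping_intervals S k p q \<longleftrightarrow>
     (\<forall>i<k. p i \<le> q i \<and> {p i..q i} \<subseteq> S) \<and>
     (\<forall>i<k. \<forall>j<k. i \<noteq> j \<longrightarrow> {p i<..<q i} \<inter> {p j<..<q j} = {})"

lemma absolutely_continuous_on_iff:
  "absolutely_continuous_on S f \<longleftrightarrow>
     (\<forall>\<epsilon>>0. \<exists>\<delta>>0. \<forall>k p q. nonoverlapping_intervals S k p q \<and> (\<Sum>i<k. q i - p i) < \<delta> \<longrightarrow>
        (\<Sum>i<k. norm (f (q i) - f (p i))) < \<epsilon>)"
  unfolding absolutely_continuous_on_def nonoverlapping_intervals_def conj_assoc ..

lemma absolutely_continuous_onE:
  assumes "absolutely_continuous_on S f" "\<epsilon> > 0"
  obtains \<delta> where "\<delta> > 0"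
    "\<And>k p q. nonoverlapping_intervals S k p q \<Longrightarrow> (\<Sum>i<k. q i - p i) < \<delta> \<Longrightarrow>
      (\<Sum>i<k. norm (f (q i) - f (p i))) < \<epsilon>"
proof -
  obtain \<delta> where "\<delta> > 0"
    and \<delta>: "\<forall>k p q. nonoverlapping_intervals S k p q \<and> (\<Sum>i<k. q i - p i) < \<delta> \<longrightarrow>
      (\<Sum>i<k. norm (f (q i) - f (p i))) < \<epsilon>"
    using assms(1)[unfolded absolutely_continuous_on_iff, THEN spec, THEN mp, OF assms(2)]
    by (elim exE conjE)
  then show thesis
    using that[OF \<open>\<delta> > 0\<close>] by simp
qed

lemma absolutely_continuous_imp_continuous_on:
  assumes "absolutely_continuous_on {a..b} f"
  shows "continuous_on {a..b} f"
  unfolding continuous_on_iff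
proof (intro ballI allI impI)
  fix t \<epsilon> :: real assume t: "t \<in> {a..b}" and "\<epsilon> > 0"
  obtain \<delta> where \<delta>: "\<delta> > 0"
    "\<And>k p q. nonoverlapping_intervals {a..b} k p q \<Longrightarrow> (\<Sum>i<k. q i - p i) < \<delta> \<Longrightarrow>
      (\<Sum>i<k. norm (f (q i) - f (p i))) < \<epsilon>"
    using assms \<open>\<epsilon> > 0\<close> by (rule absolutely_continuous_onE) blast
  have "dist (f s) (f t) < \<epsilon>" if s: "s \<in> {a..b}" "dist s t < \<delta>" for s
  proof -
    have "(\<Sum>i<(1::nat). norm (f (max s t) - f (min s t))) < \<epsilon>"
      using s t by (intro \<delta>) (auto simp: dist_real_def nonoverlapping_intervals_def)
    then show ?thesis
      by (auto simp: dist_norm max_def min_def norm_minus_commute split: if_splits)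
  qed
  with \<delta>(1) show "\<exists>\<delta>>0. \<forall>s\<in>{a..b}. dist s t < \<delta> \<longrightarrow> dist (f s) (f t) < \<epsilon>"
    by blast
qed

text \<open>The tolerance is split into three equal shares. The share for t - s is the total length
  of the intervals, so \<epsilon>' itself serves as one of the bounds on \<delta>.\<close>

lemma absolutely_continuous_on_dominated:
  assumes x: "absolutely_continuous_on S x" and y: "absolutely_continuous_on S y"
    and dom: "\<And>s t. s \<in> S \<Longrightarrow> t \<in> S \<Longrightarrow> s \<le> t \<Longrightarrow>
      norm (z t - z s) \<le> M * (norm (x t - x s) + norm (y t - y s) + (t - s))"
    and "M > 0"
  shows "absolutely_continuous_on S z"
  unfolding absolutely_continuous_on_iff
proof (intro allI impI)
  fix \<epsilon> :: real assume "\<epsilon> > 0"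
  define \<epsilon>' where "\<epsilon>' = \<epsilon> / (3 * M)"
  have "\<epsilon>' > 0" using \<open>\<epsilon> > 0\<close> \<open>M > 0\<close> by (simp add: \<epsilon>'_def)
  obtain \<delta>1 where \<delta>1: "\<delta>1 > 0"
    "\<And>k p q. nonoverlapping_intervals S k p q \<Longrightarrow> (\<Sum>i<k. q i - p i) < \<delta>1 \<Longrightarrow>
      (\<Sum>i<k. norm (x (q i) - x (p i))) < \<epsilon>'"
    using x \<open>\<epsilon>' > 0\<close> by (rule absolutely_continuous_onE) blast
  obtain \<delta>2 where \<delta>2: "\<delta>2 > 0"
    "\<And>k p q. nonoverlapping_intervals S k p q \<Longrightarrow> (\<Sum>i<k. q i - p i) < \<delta>2 \<Longrightarrow>
      (\<Sum>i<k. norm (y (q i) - y (p i))) < \<epsilon>'"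
    using y \<open>\<epsilon>' > 0\<close> by (rule absolutely_continuous_onE) blast
  show "\<exists>\<delta>>0. \<forall>k a b. nonoverlapping_intervals S k a b \<and> (\<Sum>i<k. b i - a i) < \<delta> \<longrightarrow>
      (\<Sum>i<k. norm (z (b i) - z (a i))) < \<epsilon>"
  proof (intro exI[of _ "min \<epsilon>' (min \<delta>1 \<delta>2)"] conjI allI impI)
    fix k :: nat and a b :: "nat \<Rightarrow> real"
    assume A: "nonoverlapping_intervals S k a b \<and> (\<Sum>i<k. b i - a i) < min \<epsilon>' (min \<delta>1 \<delta>2)"
    have "(\<Sum>i<k. norm (z (b i) - z (a i)))
        \<le> (\<Sum>i<k. M * (norm (x (b i) - x (a i)) + norm (y (b i) - y (a i)) + (b i - a i)))"
    proof (intro sum_mono dom)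
      fix i assume "i \<in> {..<k}"
      with A have "a i \<le> b i" "{a i..b i} \<subseteq> S" by (auto simp: nonoverlapping_intervals_def)
      then show "a i \<in> S" "b i \<in> S" "a i \<le> b i" by auto
    qed
    also have "\<dots> = M * ((\<Sum>i<k. norm (x (b i) - x (a i))) + (\<Sum>i<k. norm (y (b i) - y (a i)))
        + (\<Sum>i<k. b i - a i))"
      by (simp only: sum_distrib_left[symmetric] sum.distrib)
    also have "\<dots> < M * (\<epsilon>' + \<epsilon>' + \<epsilon>')"
      using A \<open>M > 0\<close> by (intro mult_strict_left_mono add_strict_mono \<delta>1 \<delta>2) auto
    also have "\<dots> = \<epsilon>" using \<open>M > 0\<close> by (simp add: \<epsilon>'_def)
    finally show "(\<Sum>i<k. norm (z (b i) - z (a i))) < \<epsilon>" .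
  qed (use \<open>\<epsilon>' > 0\<close> \<delta>1 \<delta>2 in simp)
qed

text \<open>By the product rule for increments: the weight is Lipschitz and x - y is bounded on a
  compact interval.\<close>

lemma absolutely_continuous_on_exp_diff:
  assumes x: "absolutely_continuous_on {a..b} x" and y: "absolutely_continuous_on {a..b} y"
    and "c > 0"
  shows "absolutely_continuous_on {a..b} (\<lambda>t. exp (c * t) *\<^sub>R (x t - y t))"
proof -
  have "bounded ((\<lambda>t. x t - y t) ` {a..b})"
    using x y by (intro compact_imp_bounded compact_continuous_image continuous_on_diff
        absolutely_continuous_imp_continuous_on) auto
  then obtain L where L: "L > 0" "\<And>t. t \<in> {a..b} \<Longrightarrow> norm (x t - y t) \<le> L"
    by (auto simp: bounded_pos)
  define M where "M = exp (c * b) * (1 + c * L)"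
  have "M > 0" using \<open>c > 0\<close> L(1) by (simp add: M_def add_pos_nonneg)
  show ?thesis
  proof (rule absolutely_continuous_on_dominated[OF x y _ \<open>M > 0\<close>])
    fix s t :: real assume st: "s \<in> {a..b}" "t \<in> {a..b}" "s \<le> t"
    let ?X = "norm (x t - x s) + norm (y t - y s)"
    have et: "exp (c * t) \<le> exp (c * b)" using st \<open>c > 0\<close> by simp
    have "exp (c * s) = exp (c * t) * exp (- (c * (t - s)))"
      by (simp add: exp_add[symmetric] algebra_simps)
    then have "exp (c * t) - exp (c * s) = exp (c * t) * (1 - exp (- (c * (t - s))))"
      by (simp add: algebra_simps)
    also have "\<dots> \<le> exp (c * b) * (c * (t - s))"
      using et exp_ge_add_one_self[of "- (c * (t - s))"] st \<open>c > 0\<close> by (intro mult_mono) auto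
    finally have e: "exp (c * t) - exp (c * s) \<le> exp (c * b) * (c * (t - s))" .
    have "exp (c * t) *\<^sub>R (x t - y t) - exp (c * s) *\<^sub>R (x s - y s)
        = exp (c * t) *\<^sub>R ((x t - x s) - (y t - y s)) + (exp (c * t) - exp (c * s)) *\<^sub>R (x s - y s)"
      by (simp add: algebra_simps)
    then have "norm (exp (c * t) *\<^sub>R (x t - y t) - exp (c * s) *\<^sub>R (x s - y s))
        \<le> norm (exp (c * t) *\<^sub>R ((x t - x s) - (y t - y s)))
          + norm ((exp (c * t) - exp (c * s)) *\<^sub>R (x s - y s))"
      by (simp only: norm_triangle_ineq)
    also have "\<dots> = exp (c * t) * norm ((x t - x s) - (y t - y s))
          + (exp (c * t) - exp (c * s)) * norm (x s - y s)"
      using st \<open>c > 0\<close> by simp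
    also have "\<dots> \<le> exp (c * b) * ?X + (exp (c * b) * (c * (t - s))) * L"
      using et e L(2)[of s] st \<open>c > 0\<close> by (intro add_mono mult_mono norm_triangle_ineq4) auto
    \<comment> \<open>The added nonnegative terms complete the product with
      \<open>M\<close>.\<close>
    also have "\<dots> \<le> \<dots> + exp (c * b) * (t - s) + exp (c * b) * c * L * ?X"
      using st \<open>c > 0\<close> L(1) by simp
    also have "\<dots> = M * (?X + (t - s))"
      by (simp add: M_def algebra_simps)
    finally show "norm (exp (c * t) *\<^sub>R (x t - y t) - exp (c * s) *\<^sub>R (x s - y s))
        \<le> M * (?X + (t - s))" .
  qed
qed

lemma sum_lessThan_append:
  fixes f g :: "nat \<Rightarrow> real"
  shows "(\<Sum>i<k+l. if i < k then f i else g (i - k)) = (\<Sum>i<k. f i) + (\<Sum>i<l. g i)"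
  by (induction l) auto

text \<open>Open intervals on the two sides of \<open>s\<close> cannot meet. This is the gluing step
  of the bisection argument.\<close>

lemma nonoverlapping_intervals_append:
  assumes 1: "nonoverlapping_intervals {r..s} k p q"
    and 2: "nonoverlapping_intervals {s..t} l p' q'"
    and "r \<le> s" "s \<le> t"
  shows "nonoverlapping_intervals {r..t} (k + l)
    (\<lambda>i. if i < k then p i else p' (i - k)) (\<lambda>i. if i < k then q i else q' (i - k))"
proof -
  define pp where "pp i = (if i < k then p i else p' (i - k))" for i
  define qq where "qq i = (if i < k then q i else q' (i - k))" for i
  have in1: "p i \<le> q i" "r \<le> p i" "q i \<le> s" if "i < k" for i
    using 1 that by (auto simp: nonoverlapping_intervals_def)
  have in2: "p' i \<le> q' i" "s \<le> p' i" "q' i \<le> t" if "i < l" for i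
    using 2 that by (auto simp: nonoverlapping_intervals_def)
  have "pp i \<le> qq i \<and> {pp i..qq i} \<subseteq> {r..t}" if i: "i < k + l" for i
  proof (cases "i < k")
    case True
    then show ?thesis using in1[OF True] \<open>s \<le> t\<close> by (auto simp: pp_def qq_def)
  next
    case False
    then have "i - k < l" using i by simp
    from in2[OF this] False show ?thesis using \<open>r \<le> s\<close> by (auto simp: pp_def qq_def)
  qed
  moreover have "{pp i<..<qq i} \<inter> {pp j<..<qq j} = {}"
    if ij: "i < k + l" "j < k + l" "i \<noteq> j" for i j
  proof -
    consider "i < k" "j < k" | "i < k" "\<not> j < k" | "\<not> i < k" "j < k" | "\<not> i < k" "\<not> j < k"
      by blast
    then show ?thesis
    proof cases
      case 1
      then show ?thesis
        using assms(1) ij by (simp add: nonoverlapping_intervals_def pp_def qq_def)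
    next
      case 2
      then have "j - k < l" using ij by simp
      from in1[OF 2(1)] in2[OF this] 2 show ?thesis by (auto simp: pp_def qq_def)
    next
      case 3
      then have "i - k < l" using ij by simp
      from in1[OF 3(2)] in2[OF this] 3 show ?thesis by (auto simp: pp_def qq_def)
    next
      case 4
      then have "i - k < l" "j - k < l" "i - k \<noteq> j - k" using ij by auto
      then show ?thesis
        using assms(2) 4 by (simp add: nonoverlapping_intervals_def pp_def qq_def)
    qed
  qed
  ultimately show ?thesis
    unfolding nonoverlapping_intervals_def pp_def qq_def by blast
qed

text \<open>Intervals around points of the exceptional null set are collected inside a small open set
  \<open>V\<close>; by absolute continuity they contribute little, and Bolzano's bisection principle patches
  the local estimates together.\<close>

lemma nonincreasing_if_locally_almost_everywhere:
  fixes f :: "real \<Rightarrow> real" and g :: "real \<Rightarrow> real^'n"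
  assumes ac: "absolutely_continuous_on {a..b} g" and "a \<le> b"
    and dom: "\<And>s t. s \<in> {a..b} \<Longrightarrow> t \<in> {a..b} \<Longrightarrow> \<bar>f t - f s\<bar> \<le> M * norm (g t - g s)"
    and "M > 0" and null: "negligible E"
    and loc: "\<And>t \<eta>. t \<in> {a..b} - E \<Longrightarrow> \<eta> > 0 \<Longrightarrow>
      \<exists>\<delta>>0. \<forall>s s'. a \<le> s \<and> s \<le> t \<and> t \<le> s' \<and> s' \<le> b \<and> s' - s < \<delta> \<longrightarrow> f s' - f s \<le> \<eta> * (s' - s)"
  shows "f b \<le> f a"
proof (rule field_le_epsilon)
  fix e :: real assume "e > 0"
  \<comment> \<open>Half of the error \<open>e\<close> is reserved for the intervals inside V, half
    for the slope \<eta> over the whole of [a, b].\<close>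
  define \<epsilon> where "\<epsilon> = e / (2 * M)"
  define \<eta> where "\<eta> = e / (2 * (b - a + 1))"
  have pos: "\<epsilon> > 0" "\<eta> > 0"
    using \<open>e > 0\<close> \<open>M > 0\<close> \<open>a \<le> b\<close> by (auto simp: \<epsilon>_def \<eta>_def)
  have "e * (b - a) \<le> e * (b - a + 1)"
    using \<open>e > 0\<close> by (intro mult_left_mono) auto
  then have \<eta>_le: "\<eta> * (b - a) \<le> e / 2"
    using \<open>a \<le> b\<close> by (simp add: \<eta>_def field_simps)
  obtain \<delta> where \<delta>: "\<delta> > 0"
    "\<And>k p q. nonoverlapping_intervals {a..b} k p q \<Longrightarrow> (\<Sum>i<k. q i - p i) < \<delta> \<Longrightarrow>
      (\<Sum>i<k. norm (g (q i) - g (p i))) < \<epsilon>"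
    using ac \<open>\<epsilon> > 0\<close> by (rule absolutely_continuous_onE) blast
  obtain V where V: "open V" "E \<subseteq> V" "V \<in> lmeasurable" "measure lebesgue V < \<delta>"
  proof -
    \<comment> \<open>Outer regularity bounds the measure of V - E; as E is null, V has the same
      measure.\<close>
    have E: "E \<in> null_sets lebesgue" using null by (simp add: negligible_iff_null_sets)
    then obtain V where V: "open V" "E \<subseteq> V" "V - E \<in> lmeasurable"
      "emeasure lebesgue (V - E) < ennreal \<delta>"
      using sets_lebesgue_outer_open[of E \<delta>] \<open>\<delta> > 0\<close> by auto
    have eq: "emeasure lebesgue V = emeasure lebesgue (V - E)"
      using E V(1) by (simp add: emeasure_Diff_null_set)
    have lt: "emeasure lebesgue V < ennreal \<delta>" using V eq by simp
    then have lm: "V \<in> lmeasurable"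
      using V(1) by (intro fmeasurableI) (auto simp: less_top[symmetric] elim: order.strict_trans)
    then have "ennreal (measure lebesgue V) < ennreal \<delta>"
      using lt by (simp add: emeasure_eq_measure2)
    then have "measure lebesgue V < \<delta>"
      by (simp add: ennreal_less_iff)
    with V lm show thesis using that by blast
  qed
  have lm: "V \<inter> {s<..t} \<in> lmeasurable" for s t
    using V(3) by (intro fmeasurable_Int_fmeasurable) auto
  \<comment> \<open>A certificate for the increment over [s, t], whose intervals are charged to the
    part of V they occupy. Half-open intervals make these charges add up exactly when certificates
    are glued.\<close>
  define good where "good s t k p q \<longleftrightarrow>
      nonoverlapping_intervals {s..t} k p q \<and>
      (\<Sum>i<k. q i - p i) \<le> measure lebesgue (V \<inter> {s<..t}) \<and>
      f t - f s \<le> \<eta> * (t - s) + M * (\<Sum>i<k. norm (g (q i) - g (p i)))"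
    for s t and k :: nat and p q :: "nat \<Rightarrow> real"
  \<comment> \<open>Conditional, because the neighbourhoods in the bisection principle may extend
    beyond [a, b].\<close>
  define P where "P s t \<longleftrightarrow> (a \<le> s \<and> t \<le> b \<longrightarrow> (\<exists>k p q. good s t k p q))" for s t
  have "P a b"
    using \<open>a \<le> b\<close>
  proof (induction rule: Bolzano)
    case (trans r s t)
    show ?case
      unfolding P_def
    proof (intro impI)
      assume *: "a \<le> r \<and> t \<le> b"
      with trans obtain k p q where 1: "good r s k p q"
        unfolding P_def by fastforce
      from * trans obtain l p' q' where 2: "good s t l p' q'"
        unfolding P_def by fastforce
      define pp where "pp i = (if i < k then p i else p' (i - k))" for i
      define qq where "qq i = (if i < k then q i else q' (i - k))" for i
      have "good r t (k + l) pp qq"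
        unfolding good_def
      proof (intro conjI)
        show "nonoverlapping_intervals {r..t} (k + l) pp qq"
          unfolding pp_def qq_def using 1 2 trans(3,4)
          by (intro nonoverlapping_intervals_append) (simp_all add: good_def)
      next
        have "(\<Sum>i<k+l. qq i - pp i) = (\<Sum>i<k+l. if i < k then q i - p i else q' (i - k) - p' (i - k))"
          by (intro sum.cong) (auto simp: pp_def qq_def)
        also have "\<dots> = (\<Sum>i<k. q i - p i) + (\<Sum>i<l. q' i - p' i)"
          by (rule sum_lessThan_append)
        also have "\<dots> \<le> measure lebesgue (V \<inter> {r<..s}) + measure lebesgue (V \<inter> {s<..t})"
          using 1 2 by (intro add_mono) (auto simp: good_def)
        also have "\<dots> = measure lebesgue ((V \<inter> {r<..s}) \<union> (V \<inter> {s<..t}))"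
          by (intro measure_Union[symmetric])
            (use fmeasurableD[OF lm] fmeasurableD2[OF lm] in auto)
        also have "(V \<inter> {r<..s}) \<union> (V \<inter> {s<..t}) = V \<inter> {r<..t}"
          using trans(3,4) by auto
        finally show "(\<Sum>i<k+l. qq i - pp i) \<le> measure lebesgue (V \<inter> {r<..t})" .
      next
        have "(\<Sum>i<k+l. norm (g (qq i) - g (pp i)))
            = (\<Sum>i<k+l. if i < k then norm (g (q i) - g (p i)) else norm (g (q' (i - k)) - g (p' (i - k))))"
          by (intro sum.cong) (auto simp: pp_def qq_def)
        also have "\<dots> = (\<Sum>i<k. norm (g (q i) - g (p i))) + (\<Sum>i<l. norm (g (q' i) - g (p' i)))"
          by (rule sum_lessThan_append)
        finally show "f t - f r \<le> \<eta> * (t - r) + M * (\<Sum>i<k+l. norm (g (qq i) - g (pp i)))"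
          using 1 2 by (simp add: good_def algebra_simps)
      qed
      then show "\<exists>k p q. good r t k p q" by blast
    qed
  next
    case (local t)
    show ?case
    proof (cases "t \<in> V")
      case True
      then obtain d where d: "d > 0" "ball t d \<subseteq> V"
        using V(1) by (auto simp: open_contains_ball)
      have "P s s'" if st: "s \<le> t" "t \<le> s'" "s' - s < d" for s s'
        unfolding P_def
      proof (intro impI)
        assume *: "a \<le> s \<and> s' \<le> b"
        have "{s<..s'} \<subseteq> ball t d"
          using st by (auto simp: dist_real_def)
        then have "V \<inter> {s<..s'} = {s<..s'}" using d by auto
        moreover have "f s' - f s \<le> \<eta> * (s' - s) + M * norm (g s' - g s)"
        proof -
          have "0 \<le> \<eta> * (s' - s)" using st pos by simp
          moreover have "f s' - f s \<le> M * norm (g s' - g s)"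
            using dom[of s s'] st * by auto
          ultimately show ?thesis by linarith
        qed
        \<comment> \<open>Inside V the whole interval is charged; off V, below, the slope bound
          works with an empty family.\<close>
        ultimately have "good s s' 1 (\<lambda>_. s) (\<lambda>_. s')"
          using st pos by (simp add: good_def nonoverlapping_intervals_def)
        then show "\<exists>k p q. good s s' k p q" by blast
      qed
      with d(1) show ?thesis by blast
    next
      case False
      then have "t \<in> {a..b} - E" using V local by auto
      from loc[OF this \<open>\<eta> > 0\<close>] obtain d where d: "d > 0"
        "\<And>s s'. a \<le> s \<Longrightarrow> s \<le> t \<Longrightarrow> t \<le> s' \<Longrightarrow> s' \<le> b \<Longrightarrow> s' - s < d \<Longrightarrow> f s' - f s \<le> \<eta> * (s' - s)"
        by blast
      have "P s s'" if "s \<le> t" "t \<le> s'" "s' - s < d" for s s'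
      proof -
        have "good s s' 0 (\<lambda>_. 0) (\<lambda>_. 0)" if "a \<le> s" "s' \<le> b"
          using d(2)[of s s'] that \<open>s \<le> t\<close> \<open>t \<le> s'\<close> \<open>s' - s < d\<close>
          by (simp add: good_def nonoverlapping_intervals_def)
        then show ?thesis unfolding P_def by blast
      qed
      with d(1) show ?thesis by blast
    qed
  qed
  then obtain k p q where k: "good a b k p q" by (auto simp: P_def)
  have "(\<Sum>i<k. q i - p i) \<le> measure lebesgue (V \<inter> {a<..b})"
    using k by (simp add: good_def)
  also have "\<dots> \<le> measure lebesgue V"
    using V(1,3) by (intro measure_mono_fmeasurable) auto
  also have "\<dots> < \<delta>" by (rule V)
  finally have len: "(\<Sum>i<k. q i - p i) < \<delta>" .
  have "(\<Sum>i<k. norm (g (q i) - g (p i))) < \<epsilon>"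
    using k len by (intro \<delta>) (simp_all add: good_def)
  then have "M * (\<Sum>i<k. norm (g (q i) - g (p i))) < M * \<epsilon>"
    using \<open>M > 0\<close> by simp
  also have "M * \<epsilon> = e / 2" using \<open>M > 0\<close> by (simp add: \<epsilon>_def)
  finally show "f b \<le> f a + e"
    using k \<eta>_le by (simp add: good_def)
qed

section \<open>Contraction of neighbouring solutions\<close>

context vector_norm
begin

text \<open>The increment straddles t. Growth controls the part after t; for the part before t,
  convexity gives 2 N(D t) <= N(D t + \<epsilon> e) + N(D t - \<epsilon> e). One half of \<eta> pays
  for linearisation, the other for growth.\<close>

lemma growth_le_locally_nonincreasing:
  assumes deriv: "(D has_vector_derivative e) (at t)" and growth: "growth_le N (D t) e 0"
    and "\<eta> > 0"
  shows "\<exists>\<delta>>0. \<forall>s s'. s \<le> t \<and> t \<le> s' \<and> s' - s < \<delta> \<longrightarrow> N (D s') - N (D s) \<le> \<eta> * (s' - s)"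
proof -
  obtain M where M: "M > 0" "\<And>x. N x \<le> M * norm x"
    by (rule N_le_norm) blast
  define \<eta>' where "\<eta>' = \<eta> / (2 * M)"
  have "\<eta>' > 0" and M\<eta>': "M * \<eta>' = \<eta> / 2" using \<open>\<eta> > 0\<close> M(1) by (simp_all add: \<eta>'_def)
  have "(D has_derivative (\<lambda>h. h *\<^sub>R e)) (at t)"
    using deriv by (simp add: has_vector_derivative_def)
  then obtain \<delta>1 where \<delta>1: "\<delta>1 > 0"
    "\<And>s. norm (s - t) < \<delta>1 \<Longrightarrow> norm (D s - D t - (s - t) *\<^sub>R e) \<le> \<eta>' * norm (s - t)"
    using \<open>\<eta>' > 0\<close> unfolding has_derivative_at_alt by blast
  have approx: "N (D s - (D t + (s - t) *\<^sub>R e)) \<le> \<eta> / 2 * \<bar>s - t\<bar>" if "\<bar>s - t\<bar> < \<delta>1" for s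
  proof -
    have "N (D s - (D t + (s - t) *\<^sub>R e)) \<le> M * norm (D s - D t - (s - t) *\<^sub>R e)"
      using M(2)[of "D s - (D t + (s - t) *\<^sub>R e)"] by (simp add: diff_diff_eq)
    also have "\<dots> \<le> M * (\<eta>' * \<bar>s - t\<bar>)"
      using \<delta>1(2)[of s] that M(1) by (intro mult_left_mono) auto
    finally show ?thesis using M\<eta>' by (simp flip: mult.assoc)
  qed
  have "\<eta> / 2 > 0" using \<open>\<eta> > 0\<close> by simp
  then have "\<forall>\<^sub>F \<epsilon> in at_right 0. N (D t + \<epsilon> *\<^sub>R e) \<le> N (D t) + \<epsilon> * (0 + \<eta> / 2)"
    using growth unfolding growth_le_def by blast
  then obtain \<delta>2 where "\<delta>2 > 0"
    and \<delta>2: "\<And>\<epsilon>. 0 < \<epsilon> \<Longrightarrow> \<epsilon> < \<delta>2 \<Longrightarrow> N (D t + \<epsilon> *\<^sub>R e) \<le> N (D t) + \<epsilon> * (\<eta> / 2)"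
    by (auto simp: eventually_at_right_field)
  have fwd: "N (D t + \<epsilon> *\<^sub>R e) \<le> N (D t) + \<epsilon> * (\<eta> / 2)" if "0 \<le> \<epsilon>" "\<epsilon> < \<delta>2" for \<epsilon>
    using \<delta>2[of \<epsilon>] that by (cases "\<epsilon> = 0") auto
  have bwd: "N (D t) - \<epsilon> * (\<eta> / 2) \<le> N (D t - \<epsilon> *\<^sub>R e)" if "0 \<le> \<epsilon>" "\<epsilon> < \<delta>2" for \<epsilon>
  proof -
    have "2 *\<^sub>R D t = (D t + \<epsilon> *\<^sub>R e) + (D t - \<epsilon> *\<^sub>R e)" by (simp add: scaleR_2)
    then have "N (2 *\<^sub>R D t) \<le> N (D t + \<epsilon> *\<^sub>R e) + N (D t - \<epsilon> *\<^sub>R e)"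
      by (simp only: N_triangle)
    then show ?thesis using fwd[OF that] by simp
  qed
  show ?thesis
  proof (intro exI[of _ "min \<delta>1 \<delta>2"] conjI allI impI)
    fix s s' assume s: "s \<le> t \<and> t \<le> s' \<and> s' - s < min \<delta>1 \<delta>2"
    have "N (D s') \<le> N (D s' - (D t + (s' - t) *\<^sub>R e)) + N (D t + (s' - t) *\<^sub>R e)"
      using N_triangle[of "D s' - (D t + (s' - t) *\<^sub>R e)" "D t + (s' - t) *\<^sub>R e"] by simp
    moreover have "N (D s' - (D t + (s' - t) *\<^sub>R e)) \<le> \<eta> / 2 * (s' - t)"
      using approx[of s'] s by simp
    moreover have "N (D t + (s' - t) *\<^sub>R e) \<le> N (D t) + (s' - t) * (\<eta> / 2)"
      by (rule fwd) (use s in auto)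
    ultimately have 1: "N (D s') \<le> \<eta> / 2 * (s' - t) + (N (D t) + (s' - t) * (\<eta> / 2))"
      by linarith
    have eq: "D t + (s - t) *\<^sub>R e = D t - (t - s) *\<^sub>R e"
      by (simp add: algebra_simps)
    have "N (D t - (t - s) *\<^sub>R e) \<le> N (D s - (D t - (t - s) *\<^sub>R e)) + N (D s)"
      using N_triangle[of "(D t - (t - s) *\<^sub>R e) - D s" "D s"]
        N_diff_commute[of "D t - (t - s) *\<^sub>R e" "D s"] by simp
    moreover have "N (D s - (D t - (t - s) *\<^sub>R e)) \<le> \<eta> / 2 * (t - s)"
      using approx[of s, unfolded eq] s by simp
    moreover have "N (D t) - (t - s) * (\<eta> / 2) \<le> N (D t - (t - s) *\<^sub>R e)"
      by (rule bwd) (use s in auto)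
    ultimately have 2: "N (D t) - (t - s) * (\<eta> / 2) \<le> \<eta> / 2 * (t - s) + N (D s)"
      by linarith
    from 1 2 show "N (D s') - N (D s) \<le> \<eta> * (s' - s)"
      by (simp add: algebra_simps)
  qed (use \<delta>1(1) \<open>\<delta>2 > 0\<close> in simp)
qed

text \<open>On the set of times where both solutions lie on the hyperplane, \<open>h \<bullet> (x - y)\<close> vanishes, so its
  derivative vanishes at every accumulation point; the isolated points form a countable set.\<close>

lemma solutions_contract:
  assumes x: "inclusion_solution F U {t0..} x" and y: "inclusion_solution F U {t0..} y"
    and "t0 \<le> t1" "c > 0"
    and growth: "\<And>t v w. t0 < t \<Longrightarrow> t < t1 \<Longrightarrow> v \<in> F t (x t) \<Longrightarrow> w \<in> F t (y t) \<Longrightarrow>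
      (h \<bullet> x t = 0 \<Longrightarrow> h \<bullet> y t = 0 \<Longrightarrow> h \<bullet> (v - w) = 0) \<Longrightarrow>
      growth_le N (x t - y t) (v - w) (- c * N (x t - y t))"
  shows "N (x t1 - y t1) \<le> exp (- c * (t1 - t0)) * N (x t0 - y t0)"
proof -
  \<comment> \<open>With this weight, contraction at rate \<open>c\<close> becomes monotonicity of
    the norm of \<open>D\<close>.\<close>
  define D where "D t = exp (c * t) *\<^sub>R (x t - y t)" for t
  define Z where "Z = {t. h \<bullet> x t = 0 \<and> h \<bullet> y t = 0}"
  obtain M where M: "M > 0" "\<And>x. N x \<le> M * norm x"
    by (rule N_le_norm) blast
  have acx: "absolutely_continuous_on {t0..t1} x" and acy: "absolutely_continuous_on {t0..t1} y"
    using x y by (auto simp: inclusion_solution_def)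
  have acD: "absolutely_continuous_on {t0..t1} D"
    unfolding D_def by (rule absolutely_continuous_on_exp_diff[OF acx acy \<open>c > 0\<close>])
  obtain E1 where E1: "E1 \<in> null_sets lebesgue"
    "\<And>t. t \<notin> E1 \<Longrightarrow> t \<ge> t0 \<Longrightarrow> \<exists>v\<in>F t (x t). (x has_vector_derivative v) (at t within {t0..})"
    using x unfolding inclusion_solution_def by (auto elim!: AE_E3)
  obtain E2 where E2: "E2 \<in> null_sets lebesgue"
    "\<And>t. t \<notin> E2 \<Longrightarrow> t \<ge> t0 \<Longrightarrow> \<exists>v\<in>F t (y t). (y has_vector_derivative v) (at t within {t0..})"
    using y unfolding inclusion_solution_def by (auto elim!: AE_E3)
  \<comment> \<open>Excluded are times without admissible derivatives, the two endpoints, so that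
    derivatives are two-sided and \<open>growth\<close> applies, and isolated common sliding
    times.\<close>
  define E where "E = E1 \<union> E2 \<union> {t0, t1} \<union> {t \<in> Z. \<not> t islimpt Z}"
  have "negligible E"
  proof -
    have "{t \<in> Z. \<not> t islimpt Z} \<in> null_sets lebesgue"
      by (intro null_sets_completionI countable_imp_null_set_lborel countable_isolated_points)
    then show ?thesis
      unfolding E_def using E1(1) E2(1)
      by (intro negligible_Un) (simp_all add: negligible_iff_null_sets)
  qed
  have "N (D t1) \<le> N (D t0)"
  proof (rule nonincreasing_if_locally_almost_everywhere[OF acD \<open>t0 \<le> t1\<close> _ M(1) \<open>negligible E\<close>])
    fix s t
    show "\<bar>N (D t) - N (D s)\<bar> \<le> M * norm (D t - D s)"
      using N_diff_bound M(2) order_trans by blast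
  next
    fix t \<eta> :: real assume t: "t \<in> {t0..t1} - E" and "\<eta> > 0"
    then have t01: "t0 < t" "t < t1" and nE: "t \<notin> E1" "t \<notin> E2" "t \<in> Z \<Longrightarrow> t islimpt Z"
      by (auto simp: E_def less_le)
    have at: "at t within {t0..} = at t"
      using t01 by (intro at_within_interior) simp
    obtain v where v: "v \<in> F t (x t)" "(x has_vector_derivative v) (at t)"
      using E1(2)[OF nE(1)] t01 at by auto
    obtain w where w: "w \<in> F t (y t)" "(y has_vector_derivative w) (at t)"
      using E2(2)[OF nE(2)] t01 at by auto
    have diff: "((\<lambda>t. x t - y t) has_vector_derivative (v - w)) (at t)"
      using v w by (intro has_vector_derivative_diff)
    have sliding: "h \<bullet> (v - w) = 0" if "h \<bullet> x t = 0" "h \<bullet> y t = 0"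
    proof -
      have "t \<in> Z" using that by (simp add: Z_def)
      have "((\<lambda>t. h \<bullet> (x t - y t)) has_vector_derivative (h \<bullet> (v - w))) (at t)"
        using diff by (rule bounded_linear.has_vector_derivative[OF bounded_linear_inner_right])
      then have "((\<lambda>t. h \<bullet> (x t - y t)) has_real_derivative (h \<bullet> (v - w))) (at t)"
        by (simp add: has_real_derivative_iff_has_vector_derivative)
      then show ?thesis
        by (rule vanishing_derivative_at_limit_point[where Z = Z])
          (use \<open>t \<in> Z\<close> nE(3) in \<open>auto simp: Z_def inner_diff_right\<close>)
    qed
    define d where "d = x t - y t"
    have "growth_le N d (v - w) (- c * N d)"
      unfolding d_def using growth[OF t01 v(1) w(1)] sliding by blast
    \<comment> \<open>The derivative of the weight contributes c d, which cancels the decay term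
      exactly.\<close>
    from growth_le_add[OF this growth_le_self[of d c]]
    have "growth_le N d (v - w + c *\<^sub>R d) 0" by simp
    from growth_le_scaleR_both[OF this, of "exp (c * t)"]
    have g: "growth_le N (D t) (exp (c * t) *\<^sub>R (v - w + c *\<^sub>R d)) 0"
      by (simp add: D_def d_def)
    have "((\<lambda>t. exp (c * t)) has_real_derivative (exp (c * t) * c)) (at t)"
      by (auto intro!: derivative_eq_intros)
    from has_vector_derivative_scaleR[OF this diff]
    have "(D has_vector_derivative (exp (c * t) *\<^sub>R (v - w) + (exp (c * t) * c) *\<^sub>R d)) (at t)"
      by (simp add: D_def[abs_def] d_def)
    then have "(D has_vector_derivative (exp (c * t) *\<^sub>R (v - w + c *\<^sub>R d))) (at t)"
      by (simp add: scaleR_add_right)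
    from growth_le_locally_nonincreasing[OF this g \<open>\<eta> > 0\<close>]
    show "\<exists>\<delta>>0. \<forall>s s'. t0 \<le> s \<and> s \<le> t \<and> t \<le> s' \<and> s' \<le> t1 \<and> s' - s < \<delta> \<longrightarrow>
        N (D s') - N (D s) \<le> \<eta> * (s' - s)"
      by blast
  qed
  then have "exp (c * t1) * N (x t1 - y t1) \<le> exp (c * t0) * N (x t0 - y t0)"
    by (simp add: D_def)
  then have "exp (- c * t1) * (exp (c * t1) * N (x t1 - y t1))
      \<le> exp (- c * t1) * (exp (c * t0) * N (x t0 - y t0))"
    by (intro mult_left_mono) auto
  then show ?thesis
    by (simp add: exp_add[symmetric] algebra_simps flip: mult.assoc)
qed

text \<open>A compact trajectory in the open set \<open>U\<close> has a tube inside
  \<open>U\<close>. At a first exit time the contraction up to that time would already give a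
  distance below the tube radius.\<close>

lemma solutions_contract_in_tube:
  assumes x: "inclusion_solution F U {t0..} x"
    and "open U" "t0 \<le> t1" "c > 0"
    and growth: "\<And>y t v w. closed_segment (x t) (y t) \<subseteq> U \<Longrightarrow> v \<in> F t (x t) \<Longrightarrow> w \<in> F t (y t) \<Longrightarrow>
      (h \<bullet> x t = 0 \<Longrightarrow> h \<bullet> y t = 0 \<Longrightarrow> h \<bullet> (v - w) = 0) \<Longrightarrow>
      growth_le N (x t - y t) (v - w) (- c * N (x t - y t))"
  obtains \<rho> where "\<rho> > 0"
    "\<And>y. inclusion_solution F U {t0..} y \<Longrightarrow> N (x t0 - y t0) < \<rho> \<Longrightarrow>
      N (x t1 - y t1) \<le> exp (- c * (t1 - t0)) * N (x t0 - y t0)"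
proof -
  have contx: "continuous_on {t0..t1} x"
    using x by (intro absolutely_continuous_imp_continuous_on) (auto simp: inclusion_solution_def)
  have "compact (x ` {t0..t1})" "x ` {t0..t1} \<subseteq> U"
    using x contx by (auto simp: inclusion_solution_def intro: compact_continuous_image)
  then obtain \<epsilon> where "\<epsilon> > 0" and \<epsilon>: "(\<Union>z\<in>x ` {t0..t1}. ball z \<epsilon>) \<subseteq> U"
    using compact_subset_open_imp_ball_epsilon_subset[OF _ \<open>open U\<close>] by metis
  obtain m where m: "m > 0" "\<And>x. norm x \<le> m * N x"
    by (rule norm_le_N) blast
  \<comment> \<open>Converts the Euclidean tube radius into a radius for \<open>N\<close>.\<close>
  define \<rho> where "\<rho> = \<epsilon> / m"
  have "\<rho> > 0" using \<open>\<epsilon> > 0\<close> m(1) by (simp add: \<rho>_def)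
  have seg: "closed_segment (x t) z \<subseteq> U" if "t \<in> {t0..t1}" "N (x t - z) < \<rho>" for t z
  proof -
    have "m * N (x t - z) < m * \<rho>" using that(2) m(1) by simp
    then have "norm (x t - z) < \<epsilon>"
      using m(2)[of "x t - z"] m(1) by (simp add: \<rho>_def)
    then have "closed_segment (x t) z \<subseteq> ball (x t) \<epsilon>"
      using \<open>\<epsilon> > 0\<close> by (intro closed_segment_subset) (auto simp: dist_norm)
    with \<epsilon> that(1) show ?thesis by blast
  qed
  show thesis
  proof (rule that[OF \<open>\<rho> > 0\<close>])
    fix y assume y: "inclusion_solution F U {t0..} y" and init: "N (x t0 - y t0) < \<rho>"
    \<comment> \<open>Closeness is required only strictly before \<open>r\<close>, so the estimate
      also holds at the first exit time itself.\<close>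
    have upto: "N (x r - y r) \<le> exp (- c * (r - t0)) * N (x t0 - y t0)"
      if r: "r \<in> {t0..t1}" and small: "\<And>t. t0 \<le> t \<Longrightarrow> t < r \<Longrightarrow> N (x t - y t) < \<rho>" for r
    proof (rule solutions_contract[OF x y _ \<open>c > 0\<close>])
      show "t0 \<le> r" using r by simp
      fix t v w assume "t0 < t" "t < r" "v \<in> F t (x t)" "w \<in> F t (y t)"
        "h \<bullet> x t = 0 \<Longrightarrow> h \<bullet> y t = 0 \<Longrightarrow> h \<bullet> (v - w) = 0"
      then show "growth_le N (x t - y t) (v - w) (- c * N (x t - y t))"
        using r by (intro growth seg small) auto
    qed
    have inside: "N (x t - y t) < \<rho>" if "t \<in> {t0..t1}" for t
    proof (rule ccontr)
      assume "\<not> N (x t - y t) < \<rho>"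
      define T where "T = {t \<in> {t0..t1}. \<rho> \<le> N (x t - y t)}"
      have conty: "continuous_on {t0..t1} y"
        using y by (intro absolutely_continuous_imp_continuous_on) (auto simp: inclusion_solution_def)
      have "continuous_on {t0..t1} (\<lambda>t. N (x t - y t))"
        using continuous_on_compose[OF continuous_on_diff[OF contx conty] continuous_on_N]
        by (simp add: o_def)
      then have "closed ({t0..t1} \<inter> (\<lambda>t. N (x t - y t)) -` {\<rho>..})"
        by (intro continuous_closed_preimage) auto
      then have "compact ({t0..t1} \<inter> ({t0..t1} \<inter> (\<lambda>t. N (x t - y t)) -` {\<rho>..}))"
        by (intro compact_Int_closed) auto
      moreover have "{t0..t1} \<inter> ({t0..t1} \<inter> (\<lambda>t. N (x t - y t)) -` {\<rho>..}) = T"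
        by (auto simp: T_def)
      ultimately have "compact T" by (simp only:)
      moreover have "T \<noteq> {}"
        using that \<open>\<not> N (x t - y t) < \<rho>\<close> by (auto simp: T_def)
      ultimately obtain r where r: "r \<in> T" "\<And>t. t \<in> T \<Longrightarrow> r \<le> t"
        using compact_attains_inf by metis
      have "N (x r - y r) \<le> exp (- c * (r - t0)) * N (x t0 - y t0)"
      proof (rule upto)
        show "r \<in> {t0..t1}" using r by (simp add: T_def)
        fix t assume "t0 \<le> t" "t < r"
        then show "N (x t - y t) < \<rho>"
          using r by (fastforce simp: T_def)
      qed
      also have "\<dots> \<le> 1 * N (x t0 - y t0)"
        using r(1) \<open>c > 0\<close> by (intro mult_right_mono) (auto simp: T_def)
      finally show False using init r(1) by (simp add: T_def)
    qed
    show "N (x t1 - y t1) \<le> exp (- c * (t1 - t0)) * N (x t0 - y t0)"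
      using \<open>t0 \<le> t1\<close> by (intro upto inside) auto
  qed
qed

section \<open>From neighbouring to distant initial points\<close>

lemma locally_lipschitz_imp_lipschitz:
  fixes \<phi> :: "real \<Rightarrow> real^'n"
  assumes loc: "\<And>r. r \<in> {0..1} \<Longrightarrow>
    \<exists>\<delta>>0. \<forall>s\<in>{0..1}. \<bar>s - r\<bar> < \<delta> \<longrightarrow> N (\<phi> r - \<phi> s) \<le> L * \<bar>r - s\<bar>"
  shows "N (\<phi> 0 - \<phi> 1) \<le> L"
proof -
  \<comment> \<open>The hypothesis compares \<open>r\<close> only with nearby points, which
    suffices: bisection asks for pairs straddling \<open>r\<close>, and these are chained through
    \<open>r\<close>.\<close>
  define P where "P a b \<longleftrightarrow> (0 \<le> a \<and> a \<le> b \<and> b \<le> 1 \<longrightarrow> N (\<phi> a - \<phi> b) \<le> L * (b - a))" for a b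
  have "P 0 1"
    using zero_le_one
  proof (induction rule: Bolzano)
    case (trans a b c)
    then show ?case
      using N_triangle_ineq[of "\<phi> a" "\<phi> c" "\<phi> b"] by (auto simp: P_def algebra_simps)
  next
    case (local r)
    then obtain \<delta> where \<delta>: "\<delta> > 0"
      "\<And>s. s \<in> {0..1} \<Longrightarrow> \<bar>s - r\<bar> < \<delta> \<Longrightarrow> N (\<phi> r - \<phi> s) \<le> L * \<bar>r - s\<bar>"
      using loc[of r] by auto
    have "P a b" if "a \<le> r" "r \<le> b" "b - a < \<delta>" for a b
      unfolding P_def
    proof
      assume "0 \<le> a \<and> a \<le> b \<and> b \<le> 1"
      then show "N (\<phi> a - \<phi> b) \<le> L * (b - a)"
        using \<delta>(2)[of a] \<delta>(2)[of b] that N_triangle_ineq[of "\<phi> a" "\<phi> b" "\<phi> r"]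
          N_diff_commute[of "\<phi> a" "\<phi> r"] by (simp add: algebra_simps)
    qed
    with \<delta>(1) show ?case by blast
  qed
  then show ?thesis by (simp add: P_def)
qed

text \<open>The gap between \<open>L\<close> and \<open>L'\<close> absorbs the remainder of the
  linear approximation.\<close>

lemma N_has_vector_derivative_bound:
  assumes deriv: "\<And>r. r \<in> {0..1} \<Longrightarrow> (\<gamma> has_vector_derivative \<gamma>' r) (at r within {0..1})"
    and bound: "\<And>r. r \<in> {0..1} \<Longrightarrow> N (\<gamma>' r) \<le> L" and "L < L'"
    and r: "r \<in> {0..1::real}"
  shows "\<exists>\<delta>>0. \<forall>s\<in>{0..1}. \<bar>s - r\<bar> < \<delta> \<longrightarrow> N (\<gamma> r - \<gamma> s) \<le> L' * \<bar>r - s\<bar>"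
proof -
  obtain M where M: "M > 0" "\<And>x. N x \<le> M * norm x"
    by (rule N_le_norm) blast
  define \<eta> where "\<eta> = (L' - L) / M"
  have "\<eta> > 0" using M(1) \<open>L < L'\<close> by (simp add: \<eta>_def)
  then obtain \<delta> where \<delta>: "\<delta> > 0"
    "\<And>s. s \<in> {0..1} \<Longrightarrow> norm (s - r) < \<delta> \<Longrightarrow>
      norm (\<gamma> s - \<gamma> r - (s - r) *\<^sub>R \<gamma>' r) \<le> \<eta> * norm (s - r)"
    using deriv[OF r] unfolding has_vector_derivative_def has_derivative_within_alt by blast
  have "N (\<gamma> r - \<gamma> s) \<le> L' * \<bar>r - s\<bar>" if s: "s \<in> {0..1}" "\<bar>s - r\<bar> < \<delta>" for s
  proof -
    have "N (\<gamma> s - \<gamma> r) \<le> N (\<gamma> s - \<gamma> r - (s - r) *\<^sub>R \<gamma>' r) + N ((s - r) *\<^sub>R \<gamma>' r)"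
      using N_triangle[of "\<gamma> s - \<gamma> r - (s - r) *\<^sub>R \<gamma>' r" "(s - r) *\<^sub>R \<gamma>' r"] by simp
    also have "N (\<gamma> s - \<gamma> r - (s - r) *\<^sub>R \<gamma>' r) \<le> M * (\<eta> * \<bar>s - r\<bar>)"
      using M(2)[of "\<gamma> s - \<gamma> r - (s - r) *\<^sub>R \<gamma>' r"] \<delta>(2)[of s] s M(1)
      by (intro order_trans[OF M(2)] mult_left_mono) auto
    also have "M * (\<eta> * \<bar>s - r\<bar>) = (L' - L) * \<bar>s - r\<bar>"
      using M(1) by (simp add: \<eta>_def)
    also have "N ((s - r) *\<^sub>R \<gamma>' r) \<le> L * \<bar>s - r\<bar>"
      using mult_right_mono[OF bound[OF r], of "\<bar>s - r\<bar>"] by (simp add: mult.commute)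
    finally show ?thesis
      by (simp add: N_diff_commute[of "\<gamma> r"] algebra_simps abs_minus_commute[of r])
  qed
  with \<delta>(1) show ?thesis by blast
qed

text \<open>The tube around each \<open>X r\<close> makes the map from the parameter to the state at
  time t1 Lipschitz near \<open>r\<close>. The tube radius may depend on \<open>r\<close>, since the
  bisection needs only a neighbourhood of each point.\<close>

lemma solutions_contract_along_curve:
  assumes "open U" "t0 \<le> t1" "c > 0"
    and growth: "\<And>x y t v w. closed_segment x y \<subseteq> U \<Longrightarrow> v \<in> F t x \<Longrightarrow> w \<in> F t y \<Longrightarrow>
      (h \<bullet> x = 0 \<Longrightarrow> h \<bullet> y = 0 \<Longrightarrow> h \<bullet> (v - w) = 0) \<Longrightarrow>
      growth_le N (x - y) (v - w) (- c * N (x - y))"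
    and sol: "\<And>r. r \<in> {0..1} \<Longrightarrow> inclusion_solution F U {t0..} (X r)"
    and deriv: "\<And>r. r \<in> {0..1} \<Longrightarrow>
      ((\<lambda>r. X r t0) has_vector_derivative \<gamma>' r) (at r within {0..1})"
    and bound: "\<And>r. r \<in> {0..1} \<Longrightarrow> N (\<gamma>' r) \<le> L"
  shows "N (X 0 t1 - X 1 t1) \<le> exp (- c * (t1 - t0)) * L"
proof (rule field_le_epsilon)
  fix \<eta> :: real assume "\<eta> > 0"
  have "N (X 0 t1 - X 1 t1) \<le> exp (- c * (t1 - t0)) * (L + \<eta>)"
  proof (rule locally_lipschitz_imp_lipschitz)
    fix r :: real assume r: "r \<in> {0..1}"
    obtain \<rho> where "\<rho> > 0"
      and \<rho>: "\<And>y. inclusion_solution F U {t0..} y \<Longrightarrow> N (X r t0 - y t0) < \<rho> \<Longrightarrow>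
        N (X r t1 - y t1) \<le> exp (- c * (t1 - t0)) * N (X r t0 - y t0)"
      by (rule solutions_contract_in_tube[OF sol[OF r] assms(1-3) growth]) blast+
    have "L < L + \<eta>" using \<open>\<eta> > 0\<close> by simp
    from N_has_vector_derivative_bound[OF deriv bound this r]
    obtain \<delta> where "\<delta> > 0"
      and \<delta>: "\<And>s. s \<in> {0..1} \<Longrightarrow> \<bar>s - r\<bar> < \<delta> \<Longrightarrow> N (X r t0 - X s t0) \<le> (L + \<eta>) * \<bar>r - s\<bar>"
      by auto
    have "L \<ge> 0" using bound[OF r] N_nonneg[of "\<gamma>' r"] by linarith
    then have pos: "L + \<eta> > 0" using \<open>\<eta> > 0\<close> by simp
    show "\<exists>\<delta>>0. \<forall>s\<in>{0..1}. \<bar>s - r\<bar> < \<delta> \<longrightarrow>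
        N (X r t1 - X s t1) \<le> exp (- c * (t1 - t0)) * (L + \<eta>) * \<bar>r - s\<bar>"
    \<comment> \<open>The second bound puts the initial points within the tube radius
      \<rho>.\<close>
    proof (intro exI[of _ "min \<delta> (\<rho> / (L + \<eta>))"] conjI ballI impI)
      fix s assume s: "s \<in> {0..1}" "\<bar>s - r\<bar> < min \<delta> (\<rho> / (L + \<eta>))"
      have le: "N (X r t0 - X s t0) \<le> (L + \<eta>) * \<bar>r - s\<bar>"
        using s by (intro \<delta>) auto
      also have "\<dots> < \<rho>"
        using s(2) pos by (simp add: field_simps abs_minus_commute)
      finally have "N (X r t1 - X s t1) \<le> exp (- c * (t1 - t0)) * N (X r t0 - X s t0)"
        using s by (intro \<rho> sol) auto
      also have "\<dots> \<le> exp (- c * (t1 - t0)) * ((L + \<eta>) * \<bar>r - s\<bar>)"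
        using le by (intro mult_left_mono) auto
      finally show "N (X r t1 - X s t1) \<le> exp (- c * (t1 - t0)) * (L + \<eta>) * \<bar>r - s\<bar>"
        by (simp add: mult.assoc)
    qed (use \<open>\<delta> > 0\<close> \<open>\<rho> > 0\<close> pos in simp)
  qed
  also have "\<dots> \<le> exp (- c * (t1 - t0)) * L + 1 * \<eta>"
    using \<open>\<eta> > 0\<close> assms(2,3) by (simp add: distrib_left)
  finally show "N (X 0 t1 - X 1 t1) \<le> exp (- c * (t1 - t0)) * L + \<eta>" by simp
qed

end

theorem proposition4:
  fixes h b1 b2 :: "real^'n"
    and A1 A2 :: "real^'n^'n"
    and B :: "real^'m^'n"
    and u :: "real \<Rightarrow> real^'m"
    and U C :: "(real^'n) set"
    and T0 :: "real set"
    and N :: "real^'n \<Rightarrow> real"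
    and K c1 c2 :: real
  assumes "h \<noteq> 0"
    and "open U"
    and "C \<subseteq> U"
    and "right_unique_solutions (pwa_filippov_map h A1 A2 b1 b2 B u) U T0"
    and "forward_invariant (pwa_filippov_map h A1 A2 b1 b2 B u) U T0 C"
    and "is_norm N"
    and "K_reachable N K C"
    and "c1 > 0" and "c2 > 0"
    and "matrix_measure N A1 \<le> - c1"
    and "matrix_measure N A2 \<le> - c2"
    and "\<forall>x\<in>{x \<in> U. h \<bullet> x = 0}. matrix_measure N (outer_prod ((A1 - A2) *v x) h) = 0"
    and "matrix_measure N (outer_prod (b1 - b2) h) = 0"
  shows "incrementally_exp_stable N (pwa_filippov_map h A1 A2 b1 b2 B u) U T0 C (min c1 c2)"
proof -
  interpret vector_norm N using assms(6) by unfold_locales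
  define c where "c = min c1 c2"
  have "c > 0" using assms(8,9) by (simp add: c_def)
  let ?F = "pwa_filippov_map h A1 A2 b1 b2 B u"
  have linear: "growth_le N d (A1 *v d) (- c * N d)" "growth_le N d (A2 *v d) (- c * N d)" for d
    using assms(10,11) by (intro growth_le_matrix_measure; simp add: c_def)+
  have jump: "growth_le N d ((h \<bullet> d) *\<^sub>R ((A1 - A2) *v z + (b1 - b2))) 0"
    if "z \<in> U" "h \<bullet> z = 0" for z d
  proof -
    \<comment> \<open>The two zero measures are combined through subadditivity of the growth
      bounds.\<close>
    have "growth_le N d (outer_prod ((A1 - A2) *v z) h *v d) (0 * N d)"
      "growth_le N d (outer_prod (b1 - b2) h *v d) (0 * N d)"
      using assms(12,13) that by (intro growth_le_matrix_measure; simp)+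
    from growth_le_add[OF this] show ?thesis
      by (simp add: outer_prod_mult scaleR_add_right)
  qed
  have growth: "growth_le N (x - y) (v - w) (- c * N (x - y))"
    if "closed_segment x y \<subseteq> U" "v \<in> ?F t x" "w \<in> ?F t y"
      "h \<bullet> x = 0 \<Longrightarrow> h \<bullet> y = 0 \<Longrightarrow> h \<bullet> (v - w) = 0" for x y t v w
    by (rule growth_le_pwa[OF linear jump assms(1) that])
  have "N (x t - y t) \<le> max 1 K * exp (- c * (t - t0)) * N (x t0 - y t0)"
    if t0: "t0 \<in> T0" and x: "inclusion_solution ?F U {t0..} x" and y: "inclusion_solution ?F U {t0..} y"
      and C: "x t0 \<in> C" "y t0 \<in> C" and "t0 \<le> t" for t0 t x y
  proof -
    obtain \<gamma> \<gamma>' where \<gamma>: "\<gamma> 0 = x t0" "\<gamma> 1 = y t0" "\<And>r. r \<in> {0..1} \<Longrightarrow> \<gamma> r \<in> C"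
      "\<And>r. r \<in> {0..1} \<Longrightarrow> (\<gamma> has_vector_derivative \<gamma>' r) (at r within {0..1})"
      "\<And>r. r \<in> {0..1} \<Longrightarrow> N (\<gamma>' r) \<le> K * N (y t0 - x t0)"
      using assms(7) C unfolding K_reachable_def by metis
    \<comment> \<open>The existence clause of forward invariance starts a solution at every point of
      the curve.\<close>
    have "\<exists>z. inclusion_solution ?F U {t0..} z \<and> z t0 = \<gamma> r" if "r \<in> {0..1}" for r
      using assms(5) t0 \<gamma>(3)[OF that] unfolding forward_invariant_def by blast
    then obtain Z where Z: "\<And>r. r \<in> {0..1} \<Longrightarrow> inclusion_solution ?F U {t0..} (Z r) \<and> Z r t0 = \<gamma> r"
      by metis
    \<comment> \<open>At the endpoints the given solutions are used, so that the estimate concerns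
      exactly x and y.\<close>
    define X where "X r = (if r = 0 then x else if r = 1 then y else Z r)" for r :: real
    have X: "inclusion_solution ?F U {t0..} (X r)" "X r t0 = \<gamma> r" if "r \<in> {0..1}" for r
      using Z[OF that] x y \<gamma>(1,2) by (auto simp: X_def)
    have deriv: "((\<lambda>r. X r t0) has_vector_derivative \<gamma>' r) (at r within {0..1})" if "r \<in> {0..1}" for r
      using that X(2) by (intro has_vector_derivative_transform[OF _ _ \<gamma>(4)]) auto
    have "N (X 0 t - X 1 t) \<le> exp (- c * (t - t0)) * (K * N (y t0 - x t0))"
      by (rule solutions_contract_along_curve[OF assms(2) \<open>t0 \<le> t\<close> \<open>c > 0\<close> growth X(1) deriv \<gamma>(5)])
    \<comment> \<open>Stability asks for a constant of at least 1, hence the maximum.\<close>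
    also have "\<dots> \<le> exp (- c * (t - t0)) * (max 1 K * N (y t0 - x t0))"
      by (intro mult_left_mono mult_right_mono) auto
    finally show ?thesis
      by (simp add: X_def N_diff_commute[of "y t0"] mult_ac)
  qed
  then show ?thesis
    unfolding incrementally_exp_stable_def c_def[symmetric] using \<open>c > 0\<close>
    by (intro conjI exI[of _ "max 1 K"]) auto
qed

end
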